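(* Let $f,g,h,p$ satisfy the standing assumption (a)--(d), suppose $\Psi=f+g+h+p$ has bounded level sets, $L_f+L_h>0$, $\beta\in(0,\rho_p^{-1}]$, and $(\tau,\alpha)$ is an admissible pair (as defined in the context). Let $\{(x^k,y^k,z^k)\}$ be generated by the algorithm with these parameters. Then there exists $\omega>0$ such that $$\min_{k=1,2,\dots,T}R(y^k,z^k)^2\le\frac{\omega}{T}\qquad\text{for all integers } T>1.$$
   Context: Notation. $\mathbb R^n$ carries the Euclidean inner product and norm. A function is $L$-smooth if it is continuously differentiable with $L$-Lipschitz gradient; $\phi$ is $\rho$-weakly convex ($\rho\ge0$) if $\phi+\frac{\rho}{2}\|\cdot\|^2$ is convex, and $\sigma$-strongly convex ($\sigma>0$) if $\phi-\frac\sigma2\|\cdot\|^2$ is convex. $\partial\phi$ denotes the limiting (Mordukhovich) subdifferential: $\xi\in\partial\phi(x)$ iff there are $x^k\to x$ with $\phi(x^k)\to\phi(x)$ and $\xi^k\to\xi$ with $\liminf_{\bar x\to x^k,\bar x\ne x^k}\frac{\phi(\bar x)-\phi(x^k)-\langle\xi^k,\bar x-x^k\rangle}{\|\bar x-x^k\|}\ge0$ for each $k$. The proximal mapping is $\mathrm{prox}_{\gamma\phi}(x)=\arg\min_w\{\phi(w)+\frac1{2\gamma}\|w-x\|^2\}$ (set-valued). Standing assumption. (a) $f:\mathbb R^n\to\mathbb R$ is $L_f$-smooth and proximable; (b) $g:\mathbb R^n\to(-\infty,\infty]$ is proper, closed (lower semicontinuous) and proximable; (c) $h:\mathbb R^n\to\mathbb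 R$ is $L_h$-smooth; (d) $p:\mathbb R^n\to\mathbb R$ is continuous on an open set containing $\mathrm{dom}(g)$ and $-p$ is $\rho_p$-weakly convex, $\rho_p\ge0$. ("Proximable" informally means that the proximal mapping is easily computable.) Conventions: $a/\infty=0$, $a/0=\infty$ for $a\ne0$, $\infty/\infty=1$; so $\rho_p^{-1}=\infty$ if $\rho_p=0$, in which case $\beta=\infty$ is allowed. Algorithm. Parameters: $\tau>0$, $\alpha\in(0,\infty)$, $\beta\in(0,\infty]$, $\gamma\in(0,\infty)$ with $\frac1\gamma=\frac1\alpha+\frac1\beta$; $\Lambda=(\alpha,\beta,\gamma)$. Starting from $(y^0,z^0)\in\mathbb R^n\times\mathbb R^n$, for all $k\ge0$: $x^k\in\mathrm{prox}_{\alpha f}(z^k)$; $y^{k+1}\in\mathrm{prox}_{\gamma g}\big(\frac\gamma\alpha(2x^k-z^k-\alpha\nabla h(x^k))+\frac\gamma\beta y^k-\gamma\xi^k\big)$ for some $\xi^k\in\partial p(y^k)$; $z^{k+1}=z^k+\tau(y^{k+1}-x^k)$. Residual. $P_\Lambda(y,z):=\bigcup\big\{\mathrm{prox}_{\gamma g}\big(\frac\gamma\alpha(2x-z-\alpha\nabla h(x))+\frac\gamma\beta y-\gamma\xi\big): x\in\mathrm{prox}_{\alpha f}(z),\ \xi\in\partial p(y)\big\}$, $T_\Lambda(y,z):=\{(y^+,\,z+\tau(y^+-\mathrm{prox}_{\alpha f}(z))): y^+\in P_\Lambda(y,z)\}$ (here $\mathrm{prox}_{\alpha f}$ is single-valued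 because $\alpha<1/L_f$), and $R(y,z):=\mathrm{dist}(0,(y,z)-T_\Lambda(y,z))$, the Euclidean distance from $0$ to the set $(y,z)-T_\Lambda(y,z)\subset\mathbb R^n\times\mathbb R^n$. Admissible pairs. Fix $\rho_f\in[0,L_f]$ such that $f$ is $\rho_f$-weakly convex. The pair $(\tau,\alpha)$, $\tau,\alpha>0$, is admissible if one of the following holds. (A) $\tau\in(0,1]$ and $\alpha\in(0,\bar\alpha)$, where $\bar\alpha=\frac1{L_f+L_h}$ if $(2-\tau)L_f-2\rho_f\ge\tau L_h$, and otherwise $\bar\alpha=\frac{\tau}{2\eta^*}$ with $\eta^*$ the positive root of $2(2-\tau)\eta^2-\tau((2-\tau)L_h+\rho_f\tau)\eta-\tau^2(\rho_f^2+L_fL_h)$. (B) $\tau\in(1,2)$ and $\alpha\in(0,\bar\alpha)$, where, for some $\sigma_h\in\mathbb R$ such that $h-\frac{\sigma_h}2\|\cdot\|^2$ is convex, $\bar\alpha_1$ is the positive root of $2L_f(L_f+L_h)\alpha^2+(\tau L_h-2(\tau-1)\sigma_h-\tau L_f)\alpha-(2-\tau)$, $\bar\alpha=\bar\alpha_1$ if $\tau\le2\bar\alpha_1(L_f-\rho_f)$, and otherwise $\bar\alpha=\frac\tau{2\eta^*}$ with $\eta^*$ the positive root of $2(2-\tau)\eta^2-\tau(\tau L_h-2(\tau-1)\sigma_h+\rho_f\tau)\eta-\tau^2(\rho_f^2+L_fL_h)$. (C) $f$ is $\sigma_f$-strongly convex with $\sigma_f>0$, $h$ is $\rho_h$-weakly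 convex with $\rho_h\in[0,L_h]$, and with $\nu=\frac{\sigma_f}{L_f+L_h}$, $\theta_0=\frac{L_h(L_f^2-\sigma_f^2)}{L_f(L_f+L_h)^2}$, $\theta_1=\frac{L_h}{L_f+L_h}$, $\theta_2=\frac{\rho_h}{L_f+L_h}$: $\tau\ge2$ satisfies $(\tau\nu-\tau\theta_1-2(\tau-1)\theta_2)^2-8(\theta_0+\nu)(\tau-2)>0$ and $\tau\nu-\tau\theta_1-2(\tau-1)\theta_2>0$, and $\alpha\in\big(\frac{\tau\mu_*}{2(L_f+L_h)},\frac{\tau\mu^*}{2(L_f+L_h)}\big)\cap\big(0,\frac1{L_f+L_h}\big)$, where $\mu_*<\mu^*$ are the two roots of $\tau^2(\theta_0+\nu)\mu^2-\tau^2(\nu-\theta_1-\frac{2(\tau-1)}\tau\theta_2)\mu+2(\tau-2)$. *)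

theory Defs
  imports "HOL-Analysis.Analysis"
begin

definition grad :: "(real^'n \<Rightarrow> real) \<Rightarrow> real^'n \<Rightarrow> real^'n" where
  "grad f x = (THE D. GDERIV f x :> D)"

definition smooth_with :: "real \<Rightarrow> (real^'n \<Rightarrow> real) \<Rightarrow> bool" where
  "smooth_with L f \<longleftrightarrow>
     (\<forall>x. GDERIV f x :> grad f x) \<and> continuous_on UNIV (grad f) \<and> L-lipschitz_on UNIV (grad f)"

definition weakly_convex :: "real \<Rightarrow> (real^'n \<Rightarrow> real) \<Rightarrow> bool" where
  "weakly_convex \<rho> \<phi> \<longleftrightarrow> \<rho> \<ge> 0 \<and> convex_on UNIV (\<lambda>x. \<phi> x + \<rho> / 2 * (norm x)\<^sup>2)"

definition strongly_convex :: "real \<Rightarrow> (real^'n \<Rightarrow> real) \<Rightarrow> bool" where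
  "strongly_convex \<sigma> \<phi> \<longleftrightarrow> \<sigma> > 0 \<and> convex_on UNIV (\<lambda>x. \<phi> x - \<sigma> / 2 * (norm x)\<^sup>2)"

definition edom :: "(real^'n \<Rightarrow> ereal) \<Rightarrow> (real^'n) set" where
  "edom g = {x. g x < \<infinity>}"

definition proper :: "(real^'n \<Rightarrow> ereal) \<Rightarrow> bool" where
  "proper g \<longleftrightarrow> (\<forall>x. g x \<noteq> -\<infinity>) \<and> edom g \<noteq> {}"

definition lower_semicont :: "(real^'n \<Rightarrow> ereal) \<Rightarrow> bool" where
  "lower_semicont g \<longleftrightarrow> (\<forall>x. g x \<le> Liminf (at x) g)"

text \<open>Regular (Frechet) and limiting (Mordukhovich) subdifferentials. Real-valued functions
  suffice, since only the subdifferential of \<open>p\<close> is used; the quotient is embedded into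
  \<^typ>\<open>ereal\<close> because its lower limit may be infinite.\<close>

definition regular_subdiff :: "(real^'n \<Rightarrow> real) \<Rightarrow> real^'n \<Rightarrow> (real^'n) set" where
  "regular_subdiff \<phi> x =
     {\<xi>. Liminf (at x) (\<lambda>u. ereal ((\<phi> u - \<phi> x - \<xi> \<bullet> (u - x)) / norm (u - x))) \<ge> 0}"

definition limiting_subdiff :: "(real^'n \<Rightarrow> real) \<Rightarrow> real^'n \<Rightarrow> (real^'n) set" where
  "limiting_subdiff \<phi> x =
     {\<xi>. \<exists>u v. u \<longlonglongrightarrow> x \<and> (\<lambda>k. \<phi> (u k)) \<longlonglongrightarrow> \<phi> x \<and> v \<longlonglongrightarrow> \<xi> \<and>
              (\<forall>k::nat. v k \<in> regular_subdiff \<phi> (u k))}"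

definition prox :: "real \<Rightarrow> (real^'n \<Rightarrow> ereal) \<Rightarrow> real^'n \<Rightarrow> (real^'n) set" where
  "prox \<gamma> \<phi> x =
     {w. is_arg_min (\<lambda>w. \<phi> w + ereal (1 / (2 * \<gamma>) * (norm (w - x))\<^sup>2)) (\<lambda>_. True) w}"

definition standing_assumption ::
  "real \<Rightarrow> real \<Rightarrow> real \<Rightarrow> (real^'n \<Rightarrow> real) \<Rightarrow> (real^'n \<Rightarrow> ereal) \<Rightarrow>
   (real^'n \<Rightarrow> real) \<Rightarrow> (real^'n \<Rightarrow> real) \<Rightarrow> bool" where
  "standing_assumption Lf Lh \<rho>p f g h p \<longleftrightarrow>
     smooth_with Lf f \<and>
     proper g \<and> lower_semicont g \<and>
     smooth_with Lh h \<and>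
     (\<exists>U. open U \<and> edom g \<subseteq> U \<and> continuous_on U p) \<and> weakly_convex \<rho>p (\<lambda>x. - p x)"

text \<open>\<open>\<beta>\<close> ranges over the extended positive reals; \<^term>\<open>ereal \<gamma> / \<beta>\<close> is \<open>0\<close> for
  \<open>\<beta> = \<infinity>\<close>, so the coefficient below is the real number meant by \<open>\<gamma>/\<beta>\<close> in all cases.\<close>

definition forward_point ::
  "real \<Rightarrow> ereal \<Rightarrow> real \<Rightarrow> (real^'n \<Rightarrow> real) \<Rightarrow>
   real^'n \<Rightarrow> real^'n \<Rightarrow> real^'n \<Rightarrow> real^'n \<Rightarrow> real^'n" where
  "forward_point \<alpha> \<beta> \<gamma> h x y z \<xi> =
     (\<gamma> / \<alpha>) *\<^sub>R (2 *\<^sub>R x - z - \<alpha> *\<^sub>R grad h x)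
     + real_of_ereal (ereal \<gamma> / \<beta>) *\<^sub>R y - \<gamma> *\<^sub>R \<xi>"

definition generated ::
  "real \<Rightarrow> real \<Rightarrow> ereal \<Rightarrow> real \<Rightarrow> (real^'n \<Rightarrow> real) \<Rightarrow> (real^'n \<Rightarrow> ereal) \<Rightarrow>
   (real^'n \<Rightarrow> real) \<Rightarrow> (real^'n \<Rightarrow> real) \<Rightarrow>
   (nat \<Rightarrow> real^'n) \<Rightarrow> (nat \<Rightarrow> real^'n) \<Rightarrow> (nat \<Rightarrow> real^'n) \<Rightarrow> bool" where
  "generated \<tau> \<alpha> \<beta> \<gamma> f g h p x y z \<longleftrightarrow>
     (\<forall>k. x k \<in> prox \<alpha> (\<lambda>w. ereal (f w)) (z k) \<and>
          (\<exists>\<xi>\<in>limiting_subdiff p (y k).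
             y (Suc k) \<in> prox \<gamma> g (forward_point \<alpha> \<beta> \<gamma> h (x k) (y k) (z k) \<xi>)) \<and>
          z (Suc k) = z k + \<tau> *\<^sub>R (y (Suc k) - x k))"

definition P_op ::
  "real \<Rightarrow> ereal \<Rightarrow> real \<Rightarrow> (real^'n \<Rightarrow> real) \<Rightarrow> (real^'n \<Rightarrow> ereal) \<Rightarrow>
   (real^'n \<Rightarrow> real) \<Rightarrow> (real^'n \<Rightarrow> real) \<Rightarrow> real^'n \<Rightarrow> real^'n \<Rightarrow> (real^'n) set" where
  "P_op \<alpha> \<beta> \<gamma> f g h p y z =
     (\<Union>x\<in>prox \<alpha> (\<lambda>w. ereal (f w)) z. \<Union>\<xi>\<in>limiting_subdiff p y.
        prox \<gamma> g (forward_point \<alpha> \<beta> \<gamma> h x y z \<xi>))"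

text \<open>For \<open>\<alpha> < 1/L\<^sub>f\<close>, which every admissible pair satisfies, the proximal mapping of \<open>f\<close> is
  single-valued; \<^const>\<open>the_elem\<close> extracts that value.\<close>

definition T_op ::
  "real \<Rightarrow> real \<Rightarrow> ereal \<Rightarrow> real \<Rightarrow> (real^'n \<Rightarrow> real) \<Rightarrow> (real^'n \<Rightarrow> ereal) \<Rightarrow>
   (real^'n \<Rightarrow> real) \<Rightarrow> (real^'n \<Rightarrow> real) \<Rightarrow> real^'n \<Rightarrow> real^'n \<Rightarrow> ((real^'n) \<times> (real^'n)) set" where
  "T_op \<tau> \<alpha> \<beta> \<gamma> f g h p y z =
     (\<lambda>y'. (y', z + \<tau> *\<^sub>R (y' - the_elem (prox \<alpha> (\<lambda>w. ereal (f w)) z))))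
       ` P_op \<alpha> \<beta> \<gamma> f g h p y z"

text \<open>\<^const>\<open>infdist\<close> to the empty set is \<open>0\<close> by convention. This case does not arise at
  iterates of the algorithm: there \<open>y (Suc k) \<in> P_op \<dots> (y k) (z k)\<close>, so the set is nonempty.
  The norm on the product type is the Euclidean one.\<close>

definition residual ::
  "real \<Rightarrow> real \<Rightarrow> ereal \<Rightarrow> real \<Rightarrow> (real^'n \<Rightarrow> real) \<Rightarrow> (real^'n \<Rightarrow> ereal) \<Rightarrow>
   (real^'n \<Rightarrow> real) \<Rightarrow> (real^'n \<Rightarrow> real) \<Rightarrow> real^'n \<Rightarrow> real^'n \<Rightarrow> real" where
  "residual \<tau> \<alpha> \<beta> \<gamma> f g h p y z =
     infdist 0 ((\<lambda>t. (y, z) - t) ` T_op \<tau> \<alpha> \<beta> \<gamma> f g h p y z)"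

text \<open>Admissible pairs. Under the standing assumption each quadratic in cases A and B has
  nonpositive constant term and nonnegative leading coefficient and hence, whenever it is used,
  exactly one positive root, so that ``the positive root'' can be bound existentially; likewise
  \<open>\<mu>1 < \<mu>2\<close> in case C are the two roots. In case B the first polynomial may be linear
  (\<open>Lf = 0\<close>).\<close>

definition admissible_A :: "real \<Rightarrow> real \<Rightarrow> real \<Rightarrow> real \<Rightarrow> real \<Rightarrow> bool" where
  "admissible_A Lf Lh \<rho>f \<tau> \<alpha> \<longleftrightarrow>
     0 < \<tau> \<and> \<tau> \<le> 1 \<and> 0 < \<alpha> \<and>
     (if (2 - \<tau>) * Lf - 2 * \<rho>f \<ge> \<tau> * Lh then \<alpha> < 1 / (Lf + Lh)
      else \<exists>\<eta>>0. 2 * (2 - \<tau>) * \<eta>\<^sup>2 - \<tau> * ((2 - \<tau>) * Lh + \<rho>f * \<tau>) * \<eta>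
                    - \<tau>\<^sup>2 * (\<rho>f\<^sup>2 + Lf * Lh) = 0 \<and>
                  \<alpha> < \<tau> / (2 * \<eta>))"

definition admissible_B ::
  "real \<Rightarrow> real \<Rightarrow> real \<Rightarrow> (real^'n \<Rightarrow> real) \<Rightarrow> real \<Rightarrow> real \<Rightarrow> bool" where
  "admissible_B Lf Lh \<rho>f h \<tau> \<alpha> \<longleftrightarrow>
     1 < \<tau> \<and> \<tau> < 2 \<and> 0 < \<alpha> \<and>
     (\<exists>\<sigma>h. convex_on UNIV (\<lambda>x. h x - \<sigma>h / 2 * (norm x)\<^sup>2) \<and>
       (\<exists>\<alpha>1>0. 2 * Lf * (Lf + Lh) * \<alpha>1\<^sup>2 + (\<tau> * Lh - 2 * (\<tau> - 1) * \<sigma>h - \<tau> * Lf) * \<alpha>1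
                    - (2 - \<tau>) = 0 \<and>
         (if \<tau> \<le> 2 * \<alpha>1 * (Lf - \<rho>f) then \<alpha> < \<alpha>1
          else \<exists>\<eta>>0. 2 * (2 - \<tau>) * \<eta>\<^sup>2 - \<tau> * (\<tau> * Lh - 2 * (\<tau> - 1) * \<sigma>h + \<rho>f * \<tau>) * \<eta>
                        - \<tau>\<^sup>2 * (\<rho>f\<^sup>2 + Lf * Lh) = 0 \<and>
                      \<alpha> < \<tau> / (2 * \<eta>))))"

definition admissible_C ::
  "real \<Rightarrow> real \<Rightarrow> (real^'n \<Rightarrow> real) \<Rightarrow> (real^'n \<Rightarrow> real) \<Rightarrow> real \<Rightarrow> real \<Rightarrow> bool" where
  "admissible_C Lf Lh f h \<tau> \<alpha> \<longleftrightarrow>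
     (\<exists>\<sigma>f \<rho>h. strongly_convex \<sigma>f f \<and> weakly_convex \<rho>h h \<and> \<rho>h \<le> Lh \<and>
       (let \<nu> = \<sigma>f / (Lf + Lh);
            \<theta>0 = Lh * (Lf\<^sup>2 - \<sigma>f\<^sup>2) / (Lf * (Lf + Lh)\<^sup>2);
            \<theta>1 = Lh / (Lf + Lh);
            \<theta>2 = \<rho>h / (Lf + Lh)
        in \<tau> \<ge> 2 \<and>
           (\<tau> * \<nu> - \<tau> * \<theta>1 - 2 * (\<tau> - 1) * \<theta>2)\<^sup>2 - 8 * (\<theta>0 + \<nu>) * (\<tau> - 2) > 0 \<and>
           \<tau> * \<nu> - \<tau> * \<theta>1 - 2 * (\<tau> - 1) * \<theta>2 > 0 \<and>
           (\<exists>\<mu>1 \<mu>2. \<mu>1 < \<mu>2 \<and>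
              (\<forall>\<mu>\<in>{\<mu>1, \<mu>2}. \<tau>\<^sup>2 * (\<theta>0 + \<nu>) * \<mu>\<^sup>2
                 - \<tau>\<^sup>2 * (\<nu> - \<theta>1 - 2 * (\<tau> - 1) / \<tau> * \<theta>2) * \<mu> + 2 * (\<tau> - 2) = 0) \<and>
              \<alpha> \<in> {\<tau> * \<mu>1 / (2 * (Lf + Lh)) <..< \<tau> * \<mu>2 / (2 * (Lf + Lh))}
                   \<inter> {0 <..< 1 / (Lf + Lh)})))"

definition admissible ::
  "real \<Rightarrow> real \<Rightarrow> real \<Rightarrow> (real^'n \<Rightarrow> real) \<Rightarrow> (real^'n \<Rightarrow> real) \<Rightarrow> real \<Rightarrow> real \<Rightarrow> bool" where
  "admissible Lf Lh \<rho>f f h \<tau> \<alpha> \<longleftrightarrow>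
     admissible_A Lf Lh \<rho>f \<tau> \<alpha> \<or> admissible_B Lf Lh \<rho>f h \<tau> \<alpha> \<or> admissible_C Lf Lh f h \<tau> \<alpha>"

end

theory Submission
  imports Defs
begin

text \<open>Write \<open>w = y\<^sup>k\<^sup>+\<^sup>1\<close> and consider the model value
  \<open>E\<^sub>k = f x + h x + \<langle>\<nabla>f x + \<nabla>h x, w - x\<rangle> + |w - x|\<^sup>2/(2\<alpha>) + g w + p y + \<langle>\<xi>, w - y\<rangle> + |w - y|\<^sup>2/(2\<beta>)\<close>
  at \<open>(x, y, \<xi>) = (x\<^sup>k, y\<^sup>k, \<xi>\<^sup>k)\<close>; the \<open>y\<close>-update minimizes exactly this function of \<open>w\<close>.
  Since \<open>\<alpha>(L\<^sub>f + L\<^sub>h) < 1\<close> and \<open>\<rho>\<^sub>p \<le> 1/\<beta>\<close>, the model majorizes \<open>\<Psi>\<close>, so \<open>E\<^sub>k \<ge> inf \<Psi> > -\<infinity>\<close>.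
  Evaluating the next model at the old \<open>w\<close>, the terms in \<open>p\<close> only help, and the remaining
  Davis--Yin part drops by at least \<open>c |x\<^sup>k\<^sup>+\<^sup>1 - x\<^sup>k|\<^sup>2\<close>; admissibility of \<open>(\<tau>, \<alpha>)\<close> is what makes
  \<open>c > 0\<close>. Hence \<open>\<Sum> |x\<^sup>k\<^sup>+\<^sup>1 - x\<^sup>k|\<^sup>2 < \<infinity>\<close>. Finally \<open>R(y\<^sup>k, z\<^sup>k)\<close> is controlled by
  \<open>|x\<^sup>k\<^sup>+\<^sup>1 - x\<^sup>k|\<close> and \<open>|x\<^sup>k - x\<^sup>k\<^sup>-\<^sup>1|\<close> because \<open>z = x + \<alpha> \<nabla>f x\<close>, and a minimum is at most an average.\<close>

section \<open>Smooth and weakly convex functions\<close>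

lemma GDERIV_line:
  fixes f :: "real^'n \<Rightarrow> real"
  assumes "GDERIV f (x + t *\<^sub>R d) :> G"
  shows "((\<lambda>s. f (x + s *\<^sub>R d)) has_real_derivative G \<bullet> d) (at t)"
proof -
  have f: "(f has_derivative (\<lambda>h. h \<bullet> G)) (at (x + t *\<^sub>R d))"
    using assms by (simp add: gderiv_def)
  have "((\<lambda>s. x + s *\<^sub>R d) has_derivative (\<lambda>s. s *\<^sub>R d)) (at t)"
    by (auto intro!: derivative_eq_intros)
  from has_derivative_compose[OF this f]
  have "((\<lambda>s. f (x + s *\<^sub>R d)) has_derivative (\<lambda>s. s *\<^sub>R d \<bullet> G)) (at t)" .
  then show ?thesis
    by (simp add: has_field_derivative_def inner_commute[of G] mult_commute_abs)
qed

lemma convex_on_above_gradient: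
  fixes \<phi> :: "real^'n \<Rightarrow> real"
  assumes cvx: "convex_on UNIV \<phi>" and G: "GDERIV \<phi> x :> G"
  shows "\<phi> x + G \<bullet> (w - x) \<le> \<phi> w"
proof -
  let ?\<psi> = "\<lambda>t. \<phi> (x + t *\<^sub>R (w - x))"
  have "convex_on UNIV ?\<psi>"
  proof (rule convex_onI)
    fix t a b :: real assume t: "0 < t" "t < 1"
    have *: "x + ((1 - t) *\<^sub>R a + t *\<^sub>R b) *\<^sub>R (w - x)
        = (1 - t) *\<^sub>R (x + a *\<^sub>R (w - x)) + t *\<^sub>R (x + b *\<^sub>R (w - x))"
      by (simp add: algebra_simps)
    show "?\<psi> ((1 - t) *\<^sub>R a + t *\<^sub>R b) \<le> (1 - t) * ?\<psi> a + t * ?\<psi> b"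
      unfolding * by (rule convex_onD[OF cvx]) (use t in auto)
  qed simp
  moreover have "(?\<psi> has_real_derivative G \<bullet> (w - x)) (at 0)"
    by (rule GDERIV_line) (simp add: G)
  ultimately have "?\<psi> 1 - ?\<psi> 0 \<ge> (G \<bullet> (w - x)) * (1 - 0)"
    by (intro convex_on_imp_above_tangent[where A = UNIV]) auto
  then show ?thesis by simp
qed

lemma smooth_with_nonneg: "smooth_with L f \<Longrightarrow> 0 \<le> L"
  by (simp add: smooth_with_def lipschitz_on_def)

lemma smooth_with_lipschitz:
  "smooth_with L f \<Longrightarrow> norm (grad f x - grad f y) \<le> L * norm (x - y)"
  by (auto simp: smooth_with_def lipschitz_on_def dist_norm)

lemma smooth_with_continuous:
  assumes "smooth_with L f"
  shows "continuous_on UNIV f"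
proof (rule has_derivative_continuous_on)
  show "(f has_derivative (\<lambda>h. h \<bullet> grad f x)) (at x)" for x
    using assms by (simp add: smooth_with_def gderiv_def)
qed

text \<open>Descent lemma. Subtracting the quadratic model along the segment from \<open>x\<close>
  to \<open>w\<close> leaves a function of \<open>t\<close> whose derivative is nonpositive by
  Cauchy-Schwarz and the Lipschitz bound.\<close>

lemma smooth_with_upper:
  assumes "smooth_with L f"
  shows "f w \<le> f x + grad f x \<bullet> (w - x) + L / 2 * (norm (w - x))\<^sup>2"
proof -
  define d where "d = w - x"
  let ?\<psi> = "\<lambda>t. f (x + t *\<^sub>R d) - t * (grad f x \<bullet> d) - L * t\<^sup>2 / 2 * (norm d)\<^sup>2"
  have "?\<psi> 1 \<le> ?\<psi> 0"
  proof (rule DERIV_nonpos_imp_nonincreasing[of 0 1 ?\<psi>])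
    fix t :: real assume t: "0 \<le> t" "t \<le> 1"
    have "GDERIV f (x + t *\<^sub>R d) :> grad f (x + t *\<^sub>R d)"
      using assms by (simp add: smooth_with_def)
    from GDERIV_line[OF this]
    have D: "(?\<psi> has_real_derivative grad f (x + t *\<^sub>R d) \<bullet> d - grad f x \<bullet> d - L * t * (norm d)\<^sup>2) (at t)"
      by (auto intro!: derivative_eq_intros)
    have "grad f (x + t *\<^sub>R d) \<bullet> d - grad f x \<bullet> d
        \<le> norm (grad f (x + t *\<^sub>R d) - grad f x) * norm d"
      by (metis inner_diff_left norm_cauchy_schwarz)
    also have "\<dots> \<le> (L * norm (x + t *\<^sub>R d - x)) * norm d"
      by (intro mult_right_mono smooth_with_lipschitz assms) simp
    also have "\<dots> = L * t * (norm d)\<^sup>2"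
      using t by (simp add: power2_eq_square)
    finally show "\<exists>y. (?\<psi> has_real_derivative y) (at t) \<and> y \<le> 0"
      using D by force
  qed simp
  then show ?thesis by (simp add: d_def)
qed

text \<open>Tangent inequality for the convex function \<open>f + \<rho>/2 |.|^2\<close>, expanded
  around \<open>x\<close>. Strong convexity enters as a negative \<rho>.\<close>

lemma smooth_with_lower:
  assumes f: "smooth_with L f" and "convex_on UNIV (\<lambda>x. f x + \<rho> / 2 * (norm x)\<^sup>2)"
  shows "f w \<ge> f x + grad f x \<bullet> (w - x) - \<rho> / 2 * (norm (w - x))\<^sup>2"
proof -
  have "(f has_derivative (\<lambda>h. h \<bullet> grad f x)) (at x)"
    using f by (simp add: smooth_with_def gderiv_def)
  then have "((\<lambda>x. f x + \<rho> / 2 * (x \<bullet> x)) has_derivative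
      (\<lambda>h. h \<bullet> grad f x + \<rho> / 2 * (x \<bullet> h + h \<bullet> x))) (at x)"
    by (auto intro!: derivative_eq_intros)
  then have "GDERIV (\<lambda>x. f x + \<rho> / 2 * (norm x)\<^sup>2) x :> grad f x + \<rho> *\<^sub>R x"
    by (simp add: gderiv_def power2_norm_eq_inner inner_add_right inner_commute)
  from convex_on_above_gradient[OF assms(2) this, of w]
  show ?thesis
    by (simp add: power2_norm_eq_inner inner_commute algebra_simps inner_diff_left inner_diff_right)
qed

text \<open>Cocoercivity of the gradient of \<open>f + \<rho>/2 |.|^2\<close>, whose increment is
  \<delta>: convexity at \<open>v\<close> and smoothness at \<open>x\<close> sandwich
  \<open>f w\<close> for every \<open>w = x + t \<delta>\<close>, and the best choice
  \<open>t = 1 / (L + \<rho>)\<close> gives the claim.\<close>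

lemma smooth_with_interpolation:
  fixes f :: "real^'n \<Rightarrow> real"
  assumes f: "smooth_with L f" and cvx: "convex_on UNIV (\<lambda>x. f x + \<rho> / 2 * (norm x)\<^sup>2)"
    and "0 \<le> L + \<rho>"
  defines "e \<equiv> \<lambda>x v. grad f v - grad f x" and "B \<equiv> \<lambda>x v. f x - f v - grad f v \<bullet> (x - v)"
  shows "(norm (e x v + \<rho> *\<^sub>R (v - x)))\<^sup>2 \<le> (L + \<rho>) * (2 * B x v + \<rho> * (norm (v - x))\<^sup>2)"
proof -
  define \<delta> where "\<delta> = e x v + \<rho> *\<^sub>R (v - x)"
  define N where "N = (norm \<delta>)\<^sup>2"
  define C where "C = 2 * B x v + \<rho> * (norm (v - x))\<^sup>2"
  have key: "(2 * t - (L + \<rho>) * t\<^sup>2) * N \<le> C" for t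
  proof -
    \<comment> \<open>compare the lower model at \<open>v\<close> with the upper model at \<open>x\<close> along the gradient of \<open>f + \<rho>/2 |.|\<^sup>2\<close>\<close>
    define w where "w = x + t *\<^sub>R \<delta>"
    have "f v + grad f v \<bullet> (w - v) - \<rho> / 2 * (norm (w - v))\<^sup>2 \<le> f w"
      by (rule smooth_with_lower[OF f cvx])
    moreover have "f w \<le> f x + grad f x \<bullet> (w - x) + L / 2 * (norm (w - x))\<^sup>2"
      by (rule smooth_with_upper[OF f])
    ultimately have 1: "grad f v \<bullet> (w - v) - grad f v \<bullet> (x - v) - grad f x \<bullet> (w - x)
        - \<rho> / 2 * (norm (w - v))\<^sup>2 - L / 2 * (norm (w - x))\<^sup>2 \<le> B x v"
      by (simp add: B_def)
    have 2: "grad f v \<bullet> (w - v) - grad f v \<bullet> (x - v) - grad f x \<bullet> (w - x) = t * (e x v \<bullet> \<delta>)"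
      by (simp add: w_def e_def algebra_simps inner_diff_left inner_diff_right)
    have 3: "(norm (w - v))\<^sup>2 = (norm (v - x))\<^sup>2 - 2 * t * ((v - x) \<bullet> \<delta>) + t\<^sup>2 * N"
    proof -
      have "w - v = t *\<^sub>R \<delta> - (v - x)" by (simp add: w_def)
      then show ?thesis
        unfolding power2_norm_eq_inner N_def
        by (simp add: inner_commute power2_eq_square algebra_simps inner_diff_left inner_diff_right)
    qed
    have 4: "(norm (w - x))\<^sup>2 = t\<^sup>2 * N"
      by (simp add: w_def N_def power_mult_distrib)
    have 5: "e x v \<bullet> \<delta> = N - \<rho> * ((v - x) \<bullet> \<delta>)"
    proof -
      have "e x v = \<delta> - \<rho> *\<^sub>R (v - x)" by (simp add: \<delta>_def)
      then show ?thesis by (simp add: N_def power2_norm_eq_inner inner_diff_left)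
    qed
    from 1[unfolded 2 3 4 5] show ?thesis
      by (simp add: C_def algebra_simps)
  qed
  have N0: "0 \<le> N" by (simp add: N_def)
  have "N \<le> (L + \<rho>) * C"
  proof (cases "L + \<rho> = 0")
    case True
    have "N = 0"
    proof (rule ccontr)
      assume "N \<noteq> 0"
      with N0 have "N > 0" by simp
      \<comment> \<open>With \<open>L + \<rho> = 0\<close> the bound \<open>key\<close> is linear in
        \<open>t\<close>, so a large \<open>t\<close> contradicts it; this one gives
        \<open>C + 1 \<le> C\<close>.\<close>
      with key[of "(C + 1) / (2 * N)"] True show False by simp
    qed
    with True show ?thesis by simp
  next
    case False
    with assms(3) have pos: "L + \<rho> > 0" by simp
    have "(2 * (1 / (L + \<rho>)) - (L + \<rho>) * (1 / (L + \<rho>))\<^sup>2) = 1 / (L + \<rho>)"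
      using pos by (simp add: power2_eq_square)
    with key[of "1 / (L + \<rho>)"] have "N / (L + \<rho>) \<le> C" by simp
    with pos show ?thesis by (simp add: field_simps)
  qed
  then show ?thesis by (simp add: N_def C_def \<delta>_def)
qed

text \<open>A regular subgradient bounds \<open>p\<close> from below near \<open>u\<close>, up to
  \<epsilon>. Applied at \<open>u - t d\<close>, behind \<open>u\<close> as seen from
  \<open>w = u + d\<close>, this turns into an upper bound at \<open>w\<close>, because
  \<open>-p + \<rho>/2 |.|^2\<close> is convex along that line. Limiting subgradients inherit the
  inequality since its right side converges.\<close>

lemma limiting_subdiff_upper:
  fixes p :: "real^'n \<Rightarrow> real"
  assumes "weakly_convex \<rho> (\<lambda>x. - p x)" and "\<xi> \<in> limiting_subdiff p y"
  shows "p w \<le> p y + \<xi> \<bullet> (w - y) + \<rho> / 2 * (norm (w - y))\<^sup>2"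
proof -
  have cvx: "convex_on UNIV (\<lambda>x. - p x + \<rho> / 2 * (norm x)\<^sup>2)"
    using assms(1) by (simp add: weakly_convex_def)
  have regular: "p w \<le> p u + v \<bullet> (w - u) + \<rho> / 2 * (norm (w - u))\<^sup>2"
    if v: "v \<in> regular_subdiff p u" for u v
  proof (cases "w = u")
    case True then show ?thesis by simp
  next
    case False
    define d where "d = w - u"
    have d: "norm d > 0" using False by (simp add: d_def)
    have bnd: "p w - p u - v \<bullet> d - \<rho> / 2 * (norm d)\<^sup>2 \<le> \<epsilon> * norm d" if \<epsilon>: "\<epsilon> > 0" for \<epsilon>
    proof -
      have "ereal (- \<epsilon>) < Liminf (at u) (\<lambda>a. ereal ((p a - p u - v \<bullet> (a - u)) / norm (a - u)))"
      proof (rule less_le_trans)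
        show "ereal (- \<epsilon>) < 0" using \<epsilon> by simp
      qed (use v in \<open>simp add: regular_subdiff_def\<close>)
      then have "\<forall>\<^sub>F a in at u. ereal (- \<epsilon>) < ereal ((p a - p u - v \<bullet> (a - u)) / norm (a - u))"
        by (rule less_LiminfD)
      then have ev: "\<forall>\<^sub>F a in at u. - \<epsilon> < (p a - p u - v \<bullet> (a - u)) / norm (a - u)" by simp
      have "filterlim (\<lambda>t. u - t *\<^sub>R d) (at u) (at_right 0)"
        unfolding filterlim_at
      proof (intro conjI)
        show "\<forall>\<^sub>F t in at_right 0. u - t *\<^sub>R d \<in> UNIV \<and> u - t *\<^sub>R d \<noteq> u"
          using d by (auto simp: eventually_at_right_less intro: eventually_mono[OF eventually_at_right_less])
        have "((\<lambda>t. u - t *\<^sub>R d) \<longlongrightarrow> u - 0 *\<^sub>R d) (at_right 0)"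
          by (intro tendsto_intros)
        then show "((\<lambda>t. u - t *\<^sub>R d) \<longlongrightarrow> u) (at_right 0)" by simp
      qed
      then have "\<forall>\<^sub>F t in at_right 0. - \<epsilon> < (p (u - t *\<^sub>R d) - p u - v \<bullet> (u - t *\<^sub>R d - u)) / norm (u - t *\<^sub>R d - u)"
        by (rule eventually_compose_filterlim[OF ev])
      then have ev2: "\<forall>\<^sub>F t in at_right 0. p w - p u - v \<bullet> d - \<rho> / 2 * (norm d)\<^sup>2 \<le> \<epsilon> * norm d + t * (\<rho> / 2 * (norm d)\<^sup>2)"
        using eventually_at_right_less[of 0]
      proof eventually_elim
        case (elim t)
        from elim have "- (\<epsilon> * (t * norm d)) < p (u - t *\<^sub>R d) - p u + t * (v \<bullet> d)"
          using d by (simp add: field_simps)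
        moreover
        \<comment> \<open>Weights placing \<open>u\<close> between \<open>u - t d\<close> and
          \<open>w\<close>; multiplication by \<open>1 + t\<close> later clears the
          denominators.\<close>
        have "u = (1 - t / (1 + t)) *\<^sub>R (u - t *\<^sub>R d) + (t / (1 + t)) *\<^sub>R w"
        proof -
          have *: "(1 + t) * (1 - t / (1 + t)) = 1" "(1 + t) * (t / (1 + t)) = t"
            using elim(2) by (simp_all add: right_diff_distrib)
          have "(1 + t) *\<^sub>R u = (1 + t) *\<^sub>R ((1 - t / (1 + t)) *\<^sub>R (u - t *\<^sub>R d) + (t / (1 + t)) *\<^sub>R w)"
            unfolding scaleR_add_right scaleR_scaleR * by (simp add: d_def algebra_simps)
          from scaleR_left_imp_eq[OF _ this] show ?thesis using elim(2) by simp
        qed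
        moreover have "- p ((1 - t / (1 + t)) *\<^sub>R (u - t *\<^sub>R d) + (t / (1 + t)) *\<^sub>R w)
           + \<rho> / 2 * (norm ((1 - t / (1 + t)) *\<^sub>R (u - t *\<^sub>R d) + (t / (1 + t)) *\<^sub>R w))\<^sup>2
           \<le> (1 - t / (1 + t)) * (- p (u - t *\<^sub>R d) + \<rho> / 2 * (norm (u - t *\<^sub>R d))\<^sup>2)
             + (t / (1 + t)) * (- p w + \<rho> / 2 * (norm w)\<^sup>2)"
          by (rule convex_onD[OF cvx]) (use elim(2) in auto)
        ultimately have c: "- p u + \<rho> / 2 * (norm u)\<^sup>2
           \<le> (1 - t / (1 + t)) * (- p (u - t *\<^sub>R d) + \<rho> / 2 * (norm (u - t *\<^sub>R d))\<^sup>2)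
             + (t / (1 + t)) * (- p w + \<rho> / 2 * (norm w)\<^sup>2)"
          and b: "- (\<epsilon> * (t * norm d)) < p (u - t *\<^sub>R d) - p u + t * (v \<bullet> d)"
          by (metis, metis)
        have ineq: "(1 + t) * (- p u + \<rho> / 2 * (norm u)\<^sup>2) \<le> 
           (- p (u - t *\<^sub>R d) + \<rho> / 2 * (norm (u - t *\<^sub>R d))\<^sup>2) + t * (- p w + \<rho> / 2 * (norm w)\<^sup>2)"
        proof -
          have "1 - t / (1 + t) = 1 / (1 + t)" using elim(2) by (simp add: field_simps)
          then show ?thesis using mult_left_mono[OF c, of "1 + t"] elim(2)
            by (simp add: distrib_left)
        qed
        have e1: "(norm (u - t *\<^sub>R d))\<^sup>2 = (norm u)\<^sup>2 - 2 * t * (u \<bullet> d) + t\<^sup>2 * (norm d)\<^sup>2"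
          unfolding power2_norm_eq_inner
          by (simp add: inner_commute power2_eq_square algebra_simps inner_diff_left inner_diff_right)
        have e2: "(norm w)\<^sup>2 = (norm u)\<^sup>2 + 2 * (u \<bullet> d) + (norm d)\<^sup>2"
          unfolding power2_norm_eq_inner d_def
          by (simp add: inner_commute algebra_simps inner_diff_left inner_diff_right)
        from ineq[unfolded e1 e2] have "t * (p w - p u - v \<bullet> d - \<rho> / 2 * (norm d)\<^sup>2)
            \<le> t * (\<epsilon> * norm d + t * (\<rho> / 2 * (norm d)\<^sup>2))"
          using b by (simp add: algebra_simps power2_eq_square add_divide_distrib)
        then show ?case using elim(2) by (simp only: mult_le_cancel_left_pos)
      qed
      \<comment> \<open>The term of order \<open>t\<close> comes from the quadratic part and
        vanishes as \<open>t\<close> tends to 0; \<epsilon> is removed afterwards.\<close>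
      have lim: "((\<lambda>t. \<epsilon> * norm d + t * (\<rho> / 2 * (norm d)\<^sup>2)) \<longlongrightarrow> \<epsilon> * norm d + 0 * (\<rho> / 2 * (norm d)\<^sup>2)) (at_right 0)"
        by (intro tendsto_intros)
      show ?thesis
        using tendsto_lowerbound[OF lim ev2] by simp
    qed
    have "p w - p u - v \<bullet> d - \<rho> / 2 * (norm d)\<^sup>2 \<le> 0"
    proof (rule field_le_epsilon)
      fix e :: real assume "e > 0"
      with bnd[of "e / norm d"] d show "p w - p u - v \<bullet> d - \<rho> / 2 * (norm d)\<^sup>2 \<le> 0 + e" by simp
    qed
    then show ?thesis by (simp add: d_def)
  qed
  obtain u v where uv: "u \<longlonglongrightarrow> y" "(\<lambda>k. p (u k)) \<longlonglongrightarrow> p y" "v \<longlonglongrightarrow> \<xi>"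
    "\<And>k::nat. v k \<in> regular_subdiff p (u k)"
    using assms(2) by (auto simp: limiting_subdiff_def)
  have "(\<lambda>k. p (u k) + v k \<bullet> (w - u k) + \<rho> / 2 * (norm (w - u k))\<^sup>2)
      \<longlonglongrightarrow> p y + \<xi> \<bullet> (w - y) + \<rho> / 2 * (norm (w - y))\<^sup>2"
    by (intro tendsto_intros uv)
  then show ?thesis
    by (rule LIMSEQ_le_const) (use regular[OF uv(4)] in auto)
qed

section \<open>Admissible step sizes\<close>

text \<open>A concave quadratic lies above its chord over \<open>[0, X]\<close>, and the chord is
  positive before \<open>X\<close>. In the identity, the last summand is the gap to the chord,
  multiplied by \<open>X\<close>.\<close>

lemma concave_quadratic_pos:
  fixes A b c t X :: real
  assumes "0 \<le> A" "0 < c" "0 \<le> c - b * X - A * X\<^sup>2" "0 \<le> t" "t < X"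
  shows "0 < c - b * t - A * t\<^sup>2"
proof -
  have "0 < (X - t) * c" using assms by simp
  moreover have "0 \<le> t * (c - b * X - A * X\<^sup>2)" using assms by simp
  moreover have "0 \<le> A * t * X * (X - t)" using assms by simp
  moreover have "X * (c - b * t - A * t\<^sup>2)
      = (X - t) * c + t * (c - b * X - A * X\<^sup>2) + A * t * X * (X - t)"
    by (simp add: algebra_simps power2_eq_square)
  ultimately have "0 < X * (c - b * t - A * t\<^sup>2)" by linarith
  then show ?thesis using assms by (simp add: zero_less_mult_iff)
qed

text \<open>\<open>\<Phi>\<close> and \<open>\<Gamma>\<close> are the decrease constants (up to the factor \<open>2\<alpha>\<tau>\<close>) when \<open>f\<close> has the extreme curvature
  \<open>-\<rho>\<close> and \<open>L\<close>, respectively; \<open>\<kappa>\<close> bounds the contribution of \<open>h\<close>. Both are concave and positive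
  at \<open>0\<close>, and they cross at \<open>\<alpha>0 = \<tau> / (2 (L - \<rho>))\<close>, which is why the case distinction of the
  admissibility conditions compares \<open>\<alpha>1\<close>, the root of \<open>\<Gamma>\<close>, with \<open>\<alpha>0\<close>.\<close>
lemma stepsize_quadratics_pos:
  fixes L Lh \<rho> \<tau> \<kappa> \<alpha> \<alpha>1 :: real
  defines "\<Phi> \<equiv> \<lambda>a. (2 - \<tau>) - (\<kappa> + \<rho> * \<tau>) * a - 2 * (\<rho>\<^sup>2 + L * Lh) * a\<^sup>2"
    and "\<Gamma> \<equiv> \<lambda>a. (2 - \<tau>) - (\<kappa> - \<tau> * L) * a - 2 * L * (L + Lh) * a\<^sup>2"
  assumes nonneg: "0 \<le> Lh" "0 \<le> \<rho>" "\<rho> \<le> L" and \<tau>: "0 < \<tau>" "\<tau> < 2" and "0 < \<alpha>"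
    and \<alpha>1: "0 < \<alpha>1" "\<Gamma> \<alpha>1 = 0"
    and bound: "if \<tau> \<le> 2 * \<alpha>1 * (L - \<rho>) then \<alpha> < \<alpha>1
      else \<exists>\<eta>>0. 2 * (2 - \<tau>) * \<eta>\<^sup>2 - \<tau> * (\<kappa> + \<rho> * \<tau>) * \<eta> - \<tau>\<^sup>2 * (\<rho>\<^sup>2 + L * Lh) = 0
        \<and> \<alpha> < \<tau> / (2 * \<eta>)"
  shows "0 < \<Phi> \<alpha>" and "0 < \<Gamma> \<alpha>"
proof -
  have L: "0 \<le> L" using nonneg by simp
  have \<Phi>_pos: "0 < \<Phi> t" if "0 \<le> \<Phi> X" "0 \<le> t" "t < X" for t X
    unfolding \<Phi>_def
    by (rule concave_quadratic_pos[of _ _ _ X]) (use that nonneg L \<tau> in \<open>auto simp: \<Phi>_def\<close>)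
  have \<Gamma>_pos: "0 < \<Gamma> t" if "0 \<le> \<Gamma> X" "0 \<le> t" "t < X" for t X
    unfolding \<Gamma>_def
    by (rule concave_quadratic_pos[of _ _ _ X]) (use that nonneg L \<tau> in \<open>auto simp: \<Gamma>_def\<close>)
  \<comment> \<open>For positive \<open>a\<close> and \<open>\<rho> < L\<close>, the last factor
    decides which function is smaller: \<Phi> up to \<open>\<alpha>0\<close>, \<Gamma> beyond
    it.\<close>
  have diff: "\<Phi> a - \<Gamma> a = a * (L + \<rho>) * (2 * a * (L - \<rho>) - \<tau>)" for a
    by (simp add: \<Phi>_def \<Gamma>_def algebra_simps power2_eq_square)
  define \<alpha>0 where "\<alpha>0 = \<tau> / (2 * (L - \<rho>))"
  have \<alpha>0: "\<Phi> \<alpha>0 = \<Gamma> \<alpha>0" if "\<rho> < L"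
  proof -
    have "2 * \<alpha>0 * (L - \<rho>) = \<tau>" using that by (simp add: \<alpha>0_def field_simps)
    then show ?thesis using diff[of \<alpha>0] by simp
  qed
  have "0 < \<Phi> \<alpha> \<and> 0 < \<Gamma> \<alpha>"
  proof (cases "\<tau> \<le> 2 * \<alpha>1 * (L - \<rho>)")
    case True
    with bound have "\<alpha> < \<alpha>1" by simp
    then have G: "0 < \<Gamma> \<alpha>" using \<Gamma>_pos[of \<alpha>1 \<alpha>] \<alpha>1 \<open>0 < \<alpha>\<close> by simp
    have "0 < 2 * \<alpha>1 * (L - \<rho>)" using True \<tau> by linarith
    then have lt: "\<rho> < L" using \<alpha>1 by (simp add: zero_less_mult_iff)
    \<comment> \<open>Beyond \<open>\<alpha>0\<close> positivity of \<Gamma> suffices. Before it,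
      \<Phi> equals \<Gamma> at \<open>\<alpha>0\<close>, is nonnegative there and hence positive at
      \<alpha>.\<close>
    show ?thesis
    proof (cases "\<tau> \<le> 2 * \<alpha> * (L - \<rho>)")
      case le: True
      then have "0 \<le> \<alpha> * (L + \<rho>) * (2 * \<alpha> * (L - \<rho>) - \<tau>)"
        using nonneg L \<open>0 < \<alpha>\<close> by simp
      with diff[of \<alpha>] G show ?thesis by linarith
    next
      case False
      then have "\<alpha> < \<alpha>0" using lt by (simp add: \<alpha>0_def field_simps)
      have "\<alpha>0 \<le> \<alpha>1" using True lt by (simp add: \<alpha>0_def field_simps)
      then have "0 \<le> \<Gamma> \<alpha>0"
        using \<Gamma>_pos[of \<alpha>1 \<alpha>0] \<alpha>1 \<open>0 < \<alpha>\<close> \<open>\<alpha> < \<alpha>0\<close> by (cases "\<alpha>0 = \<alpha>1") auto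
      then show ?thesis
        using \<Phi>_pos[of \<alpha>0 \<alpha>] \<alpha>0[OF lt] \<open>\<alpha> < \<alpha>0\<close> \<open>0 < \<alpha>\<close> G by simp
    qed
  next
    case False
    with bound obtain \<eta> where \<eta>: "\<eta> > 0"
        "2 * (2 - \<tau>) * \<eta>\<^sup>2 - \<tau> * (\<kappa> + \<rho> * \<tau>) * \<eta> - \<tau>\<^sup>2 * (\<rho>\<^sup>2 + L * Lh) = 0"
        "\<alpha> < \<tau> / (2 * \<eta>)"
      by auto
    \<comment> \<open>The substitution \<open>a = \<tau> / (2 * \<eta>)\<close> turns the polynomial
      in \<eta> into \<Phi>, up to the factor \<open>2 * \<eta>\<^sup>2\<close>.\<close>
    have "2 * \<eta>\<^sup>2 * \<Phi> (\<tau> / (2 * \<eta>)) = 2 * (2 - \<tau>) * \<eta>\<^sup>2 - \<tau> * (\<kappa> + \<rho> * \<tau>) * \<eta> - \<tau>\<^sup>2 * (\<rho>\<^sup>2 + L * Lh)"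
      using \<eta>(1) by (simp add: \<Phi>_def power2_eq_square field_simps)
    then have "\<Phi> (\<tau> / (2 * \<eta>)) = 0" using \<eta> by simp
    then have F: "0 < \<Phi> \<alpha>" using \<Phi>_pos[of "\<tau> / (2 * \<eta>)" \<alpha>] \<eta> \<open>0 < \<alpha>\<close> by simp
    \<comment> \<open>If \<alpha> lay beyond \<open>\<alpha>0\<close>, then \<Phi> and hence
      \<Gamma> would be positive at \<open>\<alpha>0\<close>, so \<Gamma> would be positive at its
      own root \<open>\<alpha>1 < \<alpha>0\<close>.\<close>
    have "2 * \<alpha> * (L - \<rho>) \<le> \<tau>"
    proof (rule ccontr)
      assume *: "\<not> 2 * \<alpha> * (L - \<rho>) \<le> \<tau>"
      then have "0 < 2 * \<alpha> * (L - \<rho>)" using \<tau> by linarith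
      then have lt: "\<rho> < L" using \<open>0 < \<alpha>\<close> by (simp add: zero_less_mult_iff)
      have "\<alpha>0 < \<alpha>" "\<alpha>1 < \<alpha>0" "0 < \<alpha>0"
        using * False lt \<tau> by (auto simp: \<alpha>0_def field_simps)
      then have "0 < \<Gamma> \<alpha>0" using \<Phi>_pos[of \<alpha> \<alpha>0] F \<alpha>0[OF lt] by simp
      then have "0 < \<Gamma> \<alpha>1" using \<Gamma>_pos[of \<alpha>0 \<alpha>1] \<open>\<alpha>1 < \<alpha>0\<close> \<alpha>1 by simp
      with \<alpha>1 show False by simp
    qed
    then have "\<alpha> * (L + \<rho>) * (2 * \<alpha> * (L - \<rho>) - \<tau>) \<le> 0"
      using nonneg L \<open>0 < \<alpha>\<close> by (simp add: mult_nonneg_nonpos)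
    with diff[of \<alpha>] F show ?thesis by linarith
  qed
  then show "0 < \<Phi> \<alpha>" "0 < \<Gamma> \<alpha>" by auto
qed

text \<open>Here \<open>n\<close> and \<open>u\<close> stand for the squared lengths of the
  increments of point and gradient, and \<open>B\<close> for a Bregman distance. For
  \<open>\<rho> < L\<close> the smallest \<open>B\<close> allowed by \<open>B0\<close> and
  \<open>B1\<close> is piecewise linear in \<open>u\<close> with kink at
  \<open>\<rho>\<^sup>2 * n\<close>, so \<open>\<tau> * B - \<alpha> * u\<close> is least at the
  kink or at \<open>L\<^sup>2 * n\<close>; these are the extreme curvatures \<open>-\<rho>\<close>
  and \<open>L\<close>.\<close>

lemma bregman_gap_lower:
  fixes L \<rho> \<tau> \<alpha> B u n :: real
  assumes "0 \<le> \<rho>" "\<rho> \<le> L" "0 < \<tau>" "0 < \<alpha>" "0 \<le> n" "u \<le> L\<^sup>2 * n"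
    and B0: "- \<rho> / 2 * n \<le> B" and B1: "u - \<rho> * L * n \<le> 2 * (L - \<rho>) * B"
  shows "min (- \<rho> * \<tau> / 2 - \<rho>\<^sup>2 * \<alpha>) (\<tau> * L / 2 - L\<^sup>2 * \<alpha>) * n \<le> \<tau> * B - \<alpha> * u"
proof (cases "u \<le> \<rho>\<^sup>2 * n")
  case True
  have "(- \<rho> * \<tau> / 2 - \<rho>\<^sup>2 * \<alpha>) * n \<le> \<tau> * B - \<alpha> * u"
  proof -
    have "\<tau> * (- \<rho> / 2 * n) \<le> \<tau> * B" using B0 assms by (intro mult_left_mono) auto
    moreover have "\<alpha> * u \<le> \<alpha> * (\<rho>\<^sup>2 * n)" using True assms by (intro mult_left_mono) auto
    moreover have "(- \<rho> * \<tau> / 2 - \<rho>\<^sup>2 * \<alpha>) * n = \<tau> * (- \<rho> / 2 * n) - \<alpha> * (\<rho>\<^sup>2 * n)"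
      by (simp add: algebra_simps)
    ultimately show ?thesis by linarith
  qed
  moreover have "min (- \<rho> * \<tau> / 2 - \<rho>\<^sup>2 * \<alpha>) (\<tau> * L / 2 - L\<^sup>2 * \<alpha>) * n
      \<le> (- \<rho> * \<tau> / 2 - \<rho>\<^sup>2 * \<alpha>) * n"
    using assms by (intro mult_right_mono) auto
  ultimately show ?thesis by linarith
next
  case False
  then have "\<rho> \<noteq> L" using assms by auto
  then have pos: "0 < 2 * (L - \<rho>)" using assms by simp
  have 1: "(\<tau> - 2 * \<alpha> * (L - \<rho>)) * u - \<tau> * \<rho> * L * n \<le> 2 * (L - \<rho>) * (\<tau> * B - \<alpha> * u)"
    using mult_left_mono[OF B1, of \<tau>] assms by (simp add: algebra_simps)
  show ?thesis
  proof (cases "2 * \<alpha> * (L - \<rho>) \<le> \<tau>")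
    case True
    have "(\<tau> - 2 * \<alpha> * (L - \<rho>)) * (\<rho>\<^sup>2 * n) \<le> (\<tau> - 2 * \<alpha> * (L - \<rho>)) * u"
      using True False by (intro mult_left_mono) auto
    with 1 have "2 * (L - \<rho>) * ((- \<rho> * \<tau> / 2 - \<rho>\<^sup>2 * \<alpha>) * n) \<le> 2 * (L - \<rho>) * (\<tau> * B - \<alpha> * u)"
      by (simp add: algebra_simps power2_eq_square)
    then have "(- \<rho> * \<tau> / 2 - \<rho>\<^sup>2 * \<alpha>) * n \<le> \<tau> * B - \<alpha> * u"
      using pos by (simp only: mult_le_cancel_left_pos)
    moreover have "min (- \<rho> * \<tau> / 2 - \<rho>\<^sup>2 * \<alpha>) (\<tau> * L / 2 - L\<^sup>2 * \<alpha>) * n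
        \<le> (- \<rho> * \<tau> / 2 - \<rho>\<^sup>2 * \<alpha>) * n"
      using assms by (intro mult_right_mono) auto
    ultimately show ?thesis by linarith
  next
    case f: False
    have "(2 * \<alpha> * (L - \<rho>) - \<tau>) * u \<le> (2 * \<alpha> * (L - \<rho>) - \<tau>) * (L\<^sup>2 * n)"
      using f assms by (intro mult_left_mono) auto
    with 1 have "2 * (L - \<rho>) * ((\<tau> * L / 2 - L\<^sup>2 * \<alpha>) * n) \<le> 2 * (L - \<rho>) * (\<tau> * B - \<alpha> * u)"
      by (simp add: algebra_simps power2_eq_square)
    then have "(\<tau> * L / 2 - L\<^sup>2 * \<alpha>) * n \<le> \<tau> * B - \<alpha> * u"
      using pos by (simp only: mult_le_cancel_left_pos)
    moreover have "min (- \<rho> * \<tau> / 2 - \<rho>\<^sup>2 * \<alpha>) (\<tau> * L / 2 - L\<^sup>2 * \<alpha>) * n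
        \<le> (\<tau> * L / 2 - L\<^sup>2 * \<alpha>) * n"
      using assms by (intro mult_right_mono) auto
    ultimately show ?thesis by linarith
  qed
qed

section \<open>One-step decrease and its estimate for weakly convex \<open>f\<close>\<close>

definition bregman :: "(real^'n \<Rightarrow> real) \<Rightarrow> real^'n \<Rightarrow> real^'n \<Rightarrow> real" where
  "bregman f x v = f x - f v - grad f v \<bullet> (x - v)"

text \<open>This is the drop \<open>M x - M v\<close> of the smooth model in
  \<open>envelope_decrease_eq\<close>, with the test point eliminated through
  \<open>w - x = (d + \<alpha> e) / \<tau>\<close>. In the iteration, \<open>x\<close> and
  \<open>v\<close> are consecutive iterates.\<close>

definition envelope_decrease ::
  "real \<Rightarrow> real \<Rightarrow> (real^'n \<Rightarrow> real) \<Rightarrow> (real^'n \<Rightarrow> real) \<Rightarrow> real^'n \<Rightarrow> real^'n \<Rightarrow> real" where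
  "envelope_decrease \<tau> \<alpha> f h x v =
     (let d = v - x; e = grad f v - grad f x; q = grad h v - grad h x
      in bregman f x v + bregman h x v - \<alpha> / \<tau> * (norm e)\<^sup>2 - q \<bullet> d / \<tau> - \<alpha> / \<tau> * (q \<bullet> e)
         + (2 - \<tau>) / (2 * \<alpha> * \<tau>) * (norm d)\<^sup>2)"

lemma inner_grad_diff_le:
  assumes f: "smooth_with Lf f" and h: "smooth_with Lh h"
  shows "(grad h v - grad h x) \<bullet> (grad f v - grad f x) \<le> Lf * Lh * (norm (v - x))\<^sup>2"
    and "(grad h v - grad h x) \<bullet> (v - x) \<le> Lh * (norm (v - x))\<^sup>2"
    and "(norm (grad f v - grad f x))\<^sup>2 \<le> Lf\<^sup>2 * (norm (v - x))\<^sup>2"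
proof -
  note lf = smooth_with_lipschitz[OF f, of v x] and lh = smooth_with_lipschitz[OF h, of v x]
  have "(grad h v - grad h x) \<bullet> (grad f v - grad f x)
      \<le> norm (grad h v - grad h x) * norm (grad f v - grad f x)"
    by (rule norm_cauchy_schwarz)
  also have "\<dots> \<le> (Lh * norm (v - x)) * (Lf * norm (v - x))"
    using smooth_with_nonneg[OF h] by (intro mult_mono lf lh) auto
  finally show "(grad h v - grad h x) \<bullet> (grad f v - grad f x) \<le> Lf * Lh * (norm (v - x))\<^sup>2"
    by (simp add: power2_eq_square mult_ac)
  have "(grad h v - grad h x) \<bullet> (v - x) \<le> norm (grad h v - grad h x) * norm (v - x)"
    by (rule norm_cauchy_schwarz)
  also have "\<dots> \<le> (Lh * norm (v - x)) * norm (v - x)"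
    by (intro mult_right_mono lh) auto
  finally show "(grad h v - grad h x) \<bullet> (v - x) \<le> Lh * (norm (v - x))\<^sup>2"
    by (simp add: power2_eq_square mult_ac)
  have "(norm (grad f v - grad f x))\<^sup>2 \<le> (Lf * norm (v - x))\<^sup>2"
    by (rule power_mono[OF lf]) simp
  then show "(norm (grad f v - grad f x))\<^sup>2 \<le> Lf\<^sup>2 * (norm (v - x))\<^sup>2"
    by (simp add: power_mult_distrib)
qed

lemma weakly_convex_monotone:
  assumes h: "smooth_with Lh h" and "convex_on UNIV (\<lambda>x. h x + \<rho> / 2 * (norm x)\<^sup>2)"
  shows "- \<rho> * (norm (v - x))\<^sup>2 \<le> (grad h v - grad h x) \<bullet> (v - x)"
  using smooth_with_lower[OF assms, of v x] smooth_with_lower[OF assms, of x v]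
  by (simp add: inner_diff_left inner_diff_right norm_minus_commute)

text \<open>The Bregman distances of \<open>h\<close> in the two orders add up to the inner product
  on the left; the descent lemma bounds the one based at \<open>x\<close>.\<close>

lemma bregman_ge_inner:
  assumes "smooth_with Lh h"
  shows "(grad h v - grad h x) \<bullet> (v - x) - Lh / 2 * (norm (v - x))\<^sup>2 \<le> bregman h x v"
  using smooth_with_upper[OF assms, of v x]
  by (simp add: bregman_def inner_diff_left inner_diff_right)

text \<open>Three separate estimates: \<open>bregman_gap_lower\<close> for \<open>f\<close>, the
  hypothesis on \<kappa> for \<open>h\<close>, and Cauchy-Schwarz for the mixed term. The two
  inequalities \<open>pos\<close> match the two branches of the minimum \<open>m\<close> and make
  \<open>c\<close> positive.\<close>

lemma envelope_decrease_weak: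
  assumes f: "smooth_with Lf f" and h: "smooth_with Lh h"
    and wc: "weakly_convex \<rho> f" "\<rho> \<le> Lf" and \<tau>: "0 < \<tau>" and \<alpha>: "0 < \<alpha>"
    and \<kappa>: "\<And>x v. - \<kappa> / 2 * (norm (v - x))\<^sup>2
       \<le> (\<tau> - 1) * ((grad h v - grad h x) \<bullet> (v - x)) - \<tau> * Lh / 2 * (norm (v - x))\<^sup>2"
    and pos: "0 < (2 - \<tau>) - (\<kappa> + \<rho> * \<tau>) * \<alpha> - 2 * (\<rho>\<^sup>2 + Lf * Lh) * \<alpha>\<^sup>2"
      "0 < (2 - \<tau>) - (\<kappa> - \<tau> * Lf) * \<alpha> - 2 * Lf * (Lf + Lh) * \<alpha>\<^sup>2"
  shows "\<exists>c>0. \<forall>x v. c * (norm (v - x))\<^sup>2 \<le> envelope_decrease \<tau> \<alpha> f h x v"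
proof -
  define m where "m = min (- \<rho> * \<tau> / 2 - \<rho>\<^sup>2 * \<alpha>) (\<tau> * Lf / 2 - Lf\<^sup>2 * \<alpha>)"
  define c where "c = (2 * \<alpha> * m - \<alpha> * \<kappa> - 2 * \<alpha>\<^sup>2 * Lf * Lh + (2 - \<tau>)) / (2 * \<alpha> * \<tau>)"
  have \<rho>: "0 \<le> \<rho>" and cvx: "convex_on UNIV (\<lambda>x. f x + \<rho> / 2 * (norm x)\<^sup>2)"
    using wc by (auto simp: weakly_convex_def)
  have "0 < 2 * \<alpha> * m - \<alpha> * \<kappa> - 2 * \<alpha>\<^sup>2 * Lf * Lh + (2 - \<tau>)"
    using pos by (auto simp: m_def min_def algebra_simps power2_eq_square)
  then have "c > 0" using \<tau> \<alpha> by (simp add: c_def)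
  moreover have "c * (norm (v - x))\<^sup>2 \<le> envelope_decrease \<tau> \<alpha> f h x v" for x v
  proof -
    define d e q where deq: "d = v - x" "e = grad f v - grad f x" "q = grad h v - grad h x"
    define n where "n = (norm d)\<^sup>2"
    define B where "B = bregman f x v"
    have B0: "- \<rho> / 2 * n \<le> B"
      using smooth_with_lower[OF f cvx, of v x]
      by (simp add: B_def bregman_def n_def deq norm_minus_commute)
    have i: "(norm (e + \<rho> *\<^sub>R d))\<^sup>2 \<le> (Lf + \<rho>) * (2 * B + \<rho> * n)"
      using smooth_with_interpolation[OF f cvx, where x = x and v = v] \<rho> wc(2)
      by (simp add: B_def bregman_def n_def deq)
    \<comment> \<open>The interpolation inequality with the points exchanged;
      \<open>e \<bullet> d - B\<close> is the Bregman distance in the reverse order.\<close>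
    have i': "(norm (e + \<rho> *\<^sub>R d))\<^sup>2 \<le> (Lf + \<rho>) * (2 * (e \<bullet> d - B) + \<rho> * n)"
    proof -
      have "norm (grad f x - grad f v + \<rho> *\<^sub>R (x - v)) = norm (e + \<rho> *\<^sub>R d)"
        unfolding deq by (subst norm_minus_cancel[symmetric]) (simp add: algebra_simps)
      moreover have "f v - f x - grad f x \<bullet> (v - x) = e \<bullet> d - B"
        by (simp add: B_def bregman_def deq inner_diff_left inner_diff_right)
      moreover have "(norm (x - v))\<^sup>2 = n"
        by (simp add: n_def deq norm_minus_commute)
      moreover have "0 \<le> Lf + \<rho>" using \<rho> wc(2) by simp
      ultimately show ?thesis
        using smooth_with_interpolation[OF f cvx, where x = v and v = x] by simp
    qed
    have ex: "(norm (e + \<rho> *\<^sub>R d))\<^sup>2 = (norm e)\<^sup>2 + 2 * \<rho> * (e \<bullet> d) + \<rho>\<^sup>2 * n"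
      unfolding power2_norm_eq_inner n_def
      by (simp add: inner_add_left inner_add_right inner_commute power2_eq_square algebra_simps)
    have B1: "(norm e)\<^sup>2 - \<rho> * Lf * n \<le> 2 * (Lf - \<rho>) * B"
    proof (cases "Lf + \<rho> = 0")
      case True
      then have "Lf = 0" "\<rho> = 0" using \<rho> wc(2) by auto
      then show ?thesis using i by simp
    next
      case False
      then have p: "0 < Lf + \<rho>" using \<rho> wc(2) by simp
      \<comment> \<open>The weights \<open>Lf\<close> and \<rho> on \<open>i\<close> and
        \<open>i'\<close> cancel \<open>e \<bullet> d\<close> and leave the common factor
        \<open>Lf + \<rho>\<close>.\<close>
      have "Lf * ((norm e)\<^sup>2 + 2 * \<rho> * (e \<bullet> d) + \<rho>\<^sup>2 * n) \<le> Lf * ((Lf + \<rho>) * (2 * B + \<rho> * n))"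
        using i \<rho> wc(2) unfolding ex by (intro mult_left_mono) auto
      moreover have "\<rho> * ((norm e)\<^sup>2 + 2 * \<rho> * (e \<bullet> d) + \<rho>\<^sup>2 * n)
          \<le> \<rho> * ((Lf + \<rho>) * (2 * (e \<bullet> d - B) + \<rho> * n))"
        using i' \<rho> unfolding ex by (intro mult_left_mono) auto
      ultimately have "(Lf + \<rho>) * ((norm e)\<^sup>2 - \<rho> * Lf * n) \<le> (Lf + \<rho>) * (2 * (Lf - \<rho>) * B)"
        by (simp add: algebra_simps power2_eq_square)
      then show ?thesis using p by (simp only: mult_le_cancel_left_pos)
    qed
    have Bf: "m * n \<le> \<tau> * B - \<alpha> * (norm e)\<^sup>2"
      unfolding m_def
      by (rule bregman_gap_lower)
         (use \<rho> wc(2) \<tau> \<alpha> B0 B1 inner_grad_diff_le(3)[OF f h, of v x] in \<open>auto simp: n_def deq\<close>)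
    have Bh: "- \<kappa> / 2 * n \<le> \<tau> * bregman h x v - q \<bullet> d"
      using mult_left_mono[OF bregman_ge_inner[OF h, of v x], of \<tau>] \<kappa>[of v x] \<tau>
      by (simp add: n_def deq algebra_simps)
    have cross: "q \<bullet> e \<le> Lf * Lh * n"
      using inner_grad_diff_le(1)[OF f h, of v x] by (simp add: n_def deq)
    have "envelope_decrease \<tau> \<alpha> f h x v * (2 * \<alpha> * \<tau>)
        = 2 * \<alpha> * (\<tau> * B - \<alpha> * (norm e)\<^sup>2) + 2 * \<alpha> * (\<tau> * bregman h x v - q \<bullet> d)
          - 2 * \<alpha>\<^sup>2 * (q \<bullet> e) + (2 - \<tau>) * n"
      using \<tau> \<alpha>
      by (simp add: envelope_decrease_def Let_def flip: deq n_def B_def)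
         (simp add: field_simps power2_eq_square)
    moreover have "2 * \<alpha> * (m * n) \<le> 2 * \<alpha> * (\<tau> * B - \<alpha> * (norm e)\<^sup>2)"
      "2 * \<alpha> * (- \<kappa> / 2 * n) \<le> 2 * \<alpha> * (\<tau> * bregman h x v - q \<bullet> d)"
      "2 * \<alpha>\<^sup>2 * (q \<bullet> e) \<le> 2 * \<alpha>\<^sup>2 * (Lf * Lh * n)"
      using \<alpha> by (intro mult_left_mono Bf Bh cross; simp)+
    moreover have "c * n * (2 * \<alpha> * \<tau>) = 2 * \<alpha> * (m * n) + 2 * \<alpha> * (- \<kappa> / 2 * n)
        - 2 * \<alpha>\<^sup>2 * (Lf * Lh * n) + (2 - \<tau>) * n"
    proof -
      have "c * (2 * \<alpha> * \<tau>) = 2 * \<alpha> * m - \<alpha> * \<kappa> - 2 * \<alpha>\<^sup>2 * Lf * Lh + (2 - \<tau>)"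
        using \<tau> \<alpha> by (simp add: c_def)
      then have "n * (c * (2 * \<alpha> * \<tau>)) = n * (2 * \<alpha> * m - \<alpha> * \<kappa> - 2 * \<alpha>\<^sup>2 * Lf * Lh + (2 - \<tau>))"
        by simp
      then show ?thesis by (simp add: algebra_simps)
    qed
    ultimately have "c * n * (2 * \<alpha> * \<tau>) \<le> envelope_decrease \<tau> \<alpha> f h x v * (2 * \<alpha> * \<tau>)"
      by linarith
    then show ?thesis
      using \<tau> \<alpha> by (simp add: n_def deq)
  qed
  ultimately show ?thesis by blast
qed

section \<open>The three admissible regimes\<close>

lemma convex_on_constant_le_smooth:
  fixes h :: "real^'n \<Rightarrow> real"
  assumes h: "smooth_with Lh h" and "convex_on UNIV (\<lambda>x. h x + \<rho> / 2 * (norm x)\<^sup>2)"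
  shows "- \<rho> \<le> Lh"
proof -
  \<comment> \<open>Any unit vector will do: along it the gradient increment is at least
    \<open>-\<rho>\<close> and at most \<open>Lh\<close>.\<close>
  define v :: "real^'n" where "v = axis undefined 1"
  have "norm v = 1" by (simp add: v_def)
  with weakly_convex_monotone[OF assms, of v 0] inner_grad_diff_le(2)[OF h h, of v 0]
  show ?thesis by simp
qed

text \<open>For \<open>\<kappa> = (2 - \<tau>) * Lh\<close> the function \<Gamma> of
  \<open>stepsize_quadratics_pos\<close> has the root \<open>1 / (Lf + Lh)\<close>, so the case
  split of A is the one made there. As \<open>\<tau> - 1\<close> is nonpositive, the
  \<open>h\<close> term calls for the upper bound \<open>Lh\<close> on its curvature.\<close>

lemma admissible_A_decrease:
  assumes f: "smooth_with Lf f" and h: "smooth_with Lh h" and L: "Lf + Lh > 0"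
    and wc: "weakly_convex \<rho> f" "\<rho> \<le> Lf" and ad: "admissible_A Lf Lh \<rho> \<tau> \<alpha>"
  shows "\<exists>c>0. \<forall>x v. c * (norm (v - x))\<^sup>2 \<le> envelope_decrease \<tau> \<alpha> f h x v" and "\<alpha> * (Lf + Lh) < 1"
proof -
  define \<kappa> where "\<kappa> = (2 - \<tau>) * Lh"
  have \<tau>: "0 < \<tau>" "\<tau> \<le> 1" and \<alpha>: "0 < \<alpha>" using ad by (auto simp: admissible_A_def)
  have nn: "0 \<le> Lf" "0 \<le> Lh" "0 \<le> \<rho>"
    using f h wc by (auto simp: weakly_convex_def smooth_with_nonneg)
  have root: "(2 - \<tau>) - (\<kappa> - \<tau> * Lf) * (1 / (Lf + Lh)) - 2 * Lf * (Lf + Lh) * (1 / (Lf + Lh))\<^sup>2 = 0"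
  proof -
    define s where "s = Lf + Lh"
    have "Lh = s - Lf" by (simp add: s_def)
    with L show ?thesis
      unfolding \<kappa>_def by (simp add: flip: s_def) (simp add: field_simps power2_eq_square)
  qed
  have iff: "(2 - \<tau>) * Lf - 2 * \<rho> \<ge> \<tau> * Lh \<longleftrightarrow> \<tau> \<le> 2 * (1 / (Lf + Lh)) * (Lf - \<rho>)"
    using L by (simp add: field_simps)
  have bound: "if \<tau> \<le> 2 * (1 / (Lf + Lh)) * (Lf - \<rho>) then \<alpha> < 1 / (Lf + Lh)
      else \<exists>\<eta>>0. 2 * (2 - \<tau>) * \<eta>\<^sup>2 - \<tau> * (\<kappa> + \<rho> * \<tau>) * \<eta> - \<tau>\<^sup>2 * (\<rho>\<^sup>2 + Lf * Lh) = 0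
        \<and> \<alpha> < \<tau> / (2 * \<eta>)"
    using ad unfolding admissible_A_def iff \<kappa>_def by blast
  have pos: "0 < (2 - \<tau>) - (\<kappa> + \<rho> * \<tau>) * \<alpha> - 2 * (\<rho>\<^sup>2 + Lf * Lh) * \<alpha>\<^sup>2"
     "0 < (2 - \<tau>) - (\<kappa> - \<tau> * Lf) * \<alpha> - 2 * Lf * (Lf + Lh) * \<alpha>\<^sup>2"
    using stepsize_quadratics_pos[OF _ _ _ _ _ _ _ root bound] nn wc(2) \<tau> \<alpha> L by auto
  show "\<exists>c>0. \<forall>x v. c * (norm (v - x))\<^sup>2 \<le> envelope_decrease \<tau> \<alpha> f h x v"
  proof (rule envelope_decrease_weak[OF f h wc \<tau>(1) \<alpha> _ pos])
    fix x v
    define S N where "S = (grad h v - grad h x) \<bullet> (v - x)" and "N = (norm (v - x))\<^sup>2"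
    have "(1 - \<tau>) * S \<le> (1 - \<tau>) * (Lh * N)" unfolding S_def N_def
      using \<tau> by (intro mult_left_mono inner_grad_diff_le(2)[OF f h]) auto
    then show "- \<kappa> / 2 * (norm (v - x))\<^sup>2
       \<le> (\<tau> - 1) * ((grad h v - grad h x) \<bullet> (v - x)) - \<tau> * Lh / 2 * (norm (v - x))\<^sup>2"
      unfolding S_def[symmetric] N_def[symmetric] by (simp add: \<kappa>_def field_simps)
  qed
  \<comment> \<open>For this \<kappa> the quadratic \<Gamma> factors completely, so the sign of the
    first factor can be read off.\<close>
  have "0 < (1 - \<alpha> * (Lf + Lh)) * ((2 - \<tau>) + 2 * \<alpha> * Lf)"
    using pos(2) by (simp add: \<kappa>_def algebra_simps power2_eq_square)
  moreover have "0 < (2 - \<tau>) + 2 * \<alpha> * Lf" using \<tau> \<alpha> nn by (simp add: add_pos_nonneg)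
  ultimately show "\<alpha> * (Lf + Lh) < 1" by (simp add: zero_less_mult_iff)
qed

text \<open>For \<open>\<tau> > 1\<close> the monotonicity term of \<open>h\<close> has a positive
  coefficient, so \<kappa> is built from the lower curvature bound \<sigma>, which may have either
  sign.\<close>

lemma admissible_B_decrease:
  assumes f: "smooth_with Lf f" and h: "smooth_with Lh h"
    and wc: "weakly_convex \<rho> f" "\<rho> \<le> Lf" and ad: "admissible_B Lf Lh \<rho> h \<tau> \<alpha>"
  shows "\<exists>c>0. \<forall>x v. c * (norm (v - x))\<^sup>2 \<le> envelope_decrease \<tau> \<alpha> f h x v" and "\<alpha> * (Lf + Lh) < 1"
proof -
  have \<tau>: "1 < \<tau>" "\<tau> < 2" and \<alpha>: "0 < \<alpha>" using ad by (auto simp: admissible_B_def)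
  have nn: "0 \<le> Lf" "0 \<le> Lh" "0 \<le> \<rho>"
    using f h wc by (auto simp: weakly_convex_def smooth_with_nonneg)
  obtain \<sigma> \<alpha>1 where cvx: "convex_on UNIV (\<lambda>x. h x - \<sigma> / 2 * (norm x)\<^sup>2)" and "0 < \<alpha>1"
    and root: "2 * Lf * (Lf + Lh) * \<alpha>1\<^sup>2 + (\<tau> * Lh - 2 * (\<tau> - 1) * \<sigma> - \<tau> * Lf) * \<alpha>1 - (2 - \<tau>) = 0"
    and bound: "if \<tau> \<le> 2 * \<alpha>1 * (Lf - \<rho>) then \<alpha> < \<alpha>1
          else \<exists>\<eta>>0. 2 * (2 - \<tau>) * \<eta>\<^sup>2 - \<tau> * (\<tau> * Lh - 2 * (\<tau> - 1) * \<sigma> + \<rho> * \<tau>) * \<eta>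
                        - \<tau>\<^sup>2 * (\<rho>\<^sup>2 + Lf * Lh) = 0 \<and> \<alpha> < \<tau> / (2 * \<eta>)"
    using ad unfolding admissible_B_def by blast
  define \<kappa> where "\<kappa> = \<tau> * Lh - 2 * (\<tau> - 1) * \<sigma>"
  have cvx': "convex_on UNIV (\<lambda>x. h x + (- \<sigma>) / 2 * (norm x)\<^sup>2)" using cvx by simp
  have root': "(2 - \<tau>) - (\<kappa> - \<tau> * Lf) * \<alpha>1 - 2 * Lf * (Lf + Lh) * \<alpha>1\<^sup>2 = 0"
    using root by (simp add: \<kappa>_def)
  have pos: "0 < (2 - \<tau>) - (\<kappa> + \<rho> * \<tau>) * \<alpha> - 2 * (\<rho>\<^sup>2 + Lf * Lh) * \<alpha>\<^sup>2"
     "0 < (2 - \<tau>) - (\<kappa> - \<tau> * Lf) * \<alpha> - 2 * Lf * (Lf + Lh) * \<alpha>\<^sup>2"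
    using stepsize_quadratics_pos[OF _ _ _ _ _ _ _ root' bound[folded \<kappa>_def]] nn wc(2) \<tau> \<alpha> \<open>0 < \<alpha>1\<close>
    by auto
  have \<tau>0: "0 < \<tau>" using \<tau> by simp
  show "\<exists>c>0. \<forall>x v. c * (norm (v - x))\<^sup>2 \<le> envelope_decrease \<tau> \<alpha> f h x v"
  proof (rule envelope_decrease_weak[OF f h wc \<tau>0 \<alpha> _ pos])
    fix x v
    define S N where "S = (grad h v - grad h x) \<bullet> (v - x)" and "N = (norm (v - x))\<^sup>2"
    have "(\<tau> - 1) * (\<sigma> * N) \<le> (\<tau> - 1) * S" unfolding S_def N_def
      using \<tau> weakly_convex_monotone[OF h cvx', of v x] by (intro mult_left_mono) auto
    then show "- \<kappa> / 2 * (norm (v - x))\<^sup>2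
       \<le> (\<tau> - 1) * ((grad h v - grad h x) \<bullet> (v - x)) - \<tau> * Lh / 2 * (norm (v - x))\<^sup>2"
      unfolding S_def[symmetric] N_def[symmetric] by (simp add: \<kappa>_def field_simps)
  qed
  \<comment> \<open>The product below exceeds \<Gamma> at \<alpha> by exactly
    \<open>2 * (\<tau> - 1) * (Lh - \<sigma>) * \<alpha>\<close>.\<close>
  have "\<sigma> \<le> Lh" using convex_on_constant_le_smooth[OF h cvx'] by simp
  then have "0 \<le> 2 * (\<tau> - 1) * (Lh - \<sigma>) * \<alpha>" using \<tau> \<alpha> by simp
  then have "0 < (1 - \<alpha> * (Lf + Lh)) * ((2 - \<tau>) + 2 * \<alpha> * Lf)"
    using pos(2) by (simp add: \<kappa>_def algebra_simps power2_eq_square)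
  moreover have "0 < (2 - \<tau>) + 2 * \<alpha> * Lf" using \<tau> \<alpha> nn by (simp add: add_pos_nonneg)
  ultimately show "\<alpha> * (Lf + Lh) < 1" by (simp add: zero_less_mult_iff)
qed

lemma quadratic_neg_between_roots:
  fixes a b c \<mu> \<mu>1 \<mu>2 :: real
  assumes "0 < a" "\<mu>1 < \<mu>" "\<mu> < \<mu>2"
    and "a * \<mu>1\<^sup>2 - b * \<mu>1 + c = 0" "a * \<mu>2\<^sup>2 - b * \<mu>2 + c = 0"
  shows "a * \<mu>\<^sup>2 - b * \<mu> + c < 0"
proof -
  have "(\<mu>2 - \<mu>1) * (a * \<mu>\<^sup>2 - b * \<mu> + c)
      = (\<mu>2 - \<mu>) * (a * \<mu>1\<^sup>2 - b * \<mu>1 + c) + (\<mu> - \<mu>1) * (a * \<mu>2\<^sup>2 - b * \<mu>2 + c)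
        - a * ((\<mu> - \<mu>1) * (\<mu>2 - \<mu>) * (\<mu>2 - \<mu>1))"
    by (simp add: algebra_simps power2_eq_square)
  also have "\<dots> < 0" using assms by simp
  finally show ?thesis using assms by (simp add: mult_less_0_iff)
qed

text \<open>For \<open>\<tau> \<ge> 2\<close> the term with \<open>2 - \<tau>\<close> is no longer
  positive, and strong convexity of \<open>f\<close> has to pay for it. After scaling by
  \<open>4 * \<alpha> * \<tau>\<close> the gain is linear in \<alpha> and this loss constant, hence
  a lower limit on \<alpha> too.\<close>

lemma admissible_C_decrease:
  assumes f: "smooth_with Lf f" and h: "smooth_with Lh h"
    and ad: "admissible_C Lf Lh f h \<tau> \<alpha>"
  shows "\<exists>c>0. \<forall>x v. c * (norm (v - x))\<^sup>2 \<le> envelope_decrease \<tau> \<alpha> f h x v" and "\<alpha> * (Lf + Lh) < 1"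
proof -
  obtain \<sigma> \<rho>h \<mu>1 \<mu>2 where sc: "strongly_convex \<sigma> f" and wch: "weakly_convex \<rho>h h" and \<tau>: "2 \<le> \<tau>"
    and roots: "\<forall>\<mu>\<in>{\<mu>1, \<mu>2}. \<tau>\<^sup>2 * (Lh * (Lf\<^sup>2 - \<sigma>\<^sup>2) / (Lf * (Lf + Lh)\<^sup>2) + \<sigma> / (Lf + Lh)) * \<mu>\<^sup>2
       - \<tau>\<^sup>2 * (\<sigma> / (Lf + Lh) - Lh / (Lf + Lh) - 2 * (\<tau> - 1) / \<tau> * (\<rho>h / (Lf + Lh))) * \<mu> + 2 * (\<tau> - 2) = 0"
    and \<alpha>: "\<alpha> \<in> {\<tau> * \<mu>1 / (2 * (Lf + Lh)) <..< \<tau> * \<mu>2 / (2 * (Lf + Lh))} \<inter> {0 <..< 1 / (Lf + Lh)}"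
    using ad unfolding admissible_C_def Let_def by blast
  have nn: "0 \<le> Lf" "0 \<le> Lh"
    using f h by (auto simp: smooth_with_nonneg)
  have \<sigma>: "0 < \<sigma>" and cvx: "convex_on UNIV (\<lambda>x. f x + (- \<sigma>) / 2 * (norm x)\<^sup>2)"
    using sc by (auto simp: strongly_convex_def)
  have cvxh: "convex_on UNIV (\<lambda>x. h x + \<rho>h / 2 * (norm x)\<^sup>2)"
    using wch by (auto simp: weakly_convex_def)
  have \<sigma>L: "\<sigma> \<le> Lf" using convex_on_constant_le_smooth[OF f cvx] by simp
  define s where "s = Lf + Lh"
  have Lf: "0 < Lf" and s: "0 < s" using \<sigma> \<sigma>L nn by (auto simp: s_def)
  have \<alpha>0: "0 < \<alpha>" and \<alpha>s: "\<alpha> * s < 1"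
    and \<mu>: "\<mu>1 < 2 * s * \<alpha> / \<tau>" "2 * s * \<alpha> / \<tau> < \<mu>2"
    using \<alpha> s \<tau> by (auto simp: field_simps simp flip: s_def)
  show "\<alpha> * (Lf + Lh) < 1" using \<alpha>s by (simp add: s_def)
  have "0 \<le> Lh * (Lf\<^sup>2 - \<sigma>\<^sup>2) / (Lf * (Lf + Lh)\<^sup>2)"
    using \<sigma> \<sigma>L nn by (intro divide_nonneg_nonneg mult_nonneg_nonneg) (auto simp: power_mono)
  then have lead: "0 < \<tau>\<^sup>2 * (Lh * (Lf\<^sup>2 - \<sigma>\<^sup>2) / (Lf * (Lf + Lh)\<^sup>2) + \<sigma> / (Lf + Lh))"
    using \<sigma> s \<tau> by (intro mult_pos_pos add_nonneg_pos) (auto simp: s_def)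
  \<comment> \<open>The scaling that maps the interval for \<alpha> to the one between the roots
    \<open>\<mu>1\<close> and \<open>\<mu>2\<close>.\<close>
  define \<mu> where "\<mu> = 2 * s * \<alpha> / \<tau>"
  have neg: "\<tau>\<^sup>2 * (Lh * (Lf\<^sup>2 - \<sigma>\<^sup>2) / (Lf * s\<^sup>2) + \<sigma> / s) * \<mu>\<^sup>2
       - \<tau>\<^sup>2 * (\<sigma> / s - Lh / s - 2 * (\<tau> - 1) / \<tau> * (\<rho>h / s)) * \<mu> + 2 * (\<tau> - 2) < 0"
    using quadratic_neg_between_roots[OF lead, of \<mu>1 \<mu> \<mu>2] roots \<mu>
    by (simp add: \<mu>_def s_def)
  \<comment> \<open>Minus the quadratic at \<mu>, rewritten in \<alpha>.\<close>
  define c where "c = 2 * \<alpha> * (\<tau> * \<sigma> - \<tau> * Lh - 2 * (\<tau> - 1) * \<rho>h) - 2 * (\<tau> - 2)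
    - 4 * \<alpha>\<^sup>2 * (Lh * (Lf\<^sup>2 - \<sigma>\<^sup>2) / Lf + \<sigma> * s)"
  have "\<tau>\<^sup>2 * (Lh * (Lf\<^sup>2 - \<sigma>\<^sup>2) / (Lf * s\<^sup>2) + \<sigma> / s) * \<mu>\<^sup>2
       - \<tau>\<^sup>2 * (\<sigma> / s - Lh / s - 2 * (\<tau> - 1) / \<tau> * (\<rho>h / s)) * \<mu> + 2 * (\<tau> - 2) = - c"
  proof -
    have "\<tau>\<^sup>2 * (Lh * (Lf\<^sup>2 - \<sigma>\<^sup>2) / (Lf * s\<^sup>2) + \<sigma> / s) * \<mu>\<^sup>2
        = 4 * \<alpha>\<^sup>2 * (Lh * (Lf\<^sup>2 - \<sigma>\<^sup>2) / Lf + \<sigma> * s)"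
      using \<tau> s Lf unfolding \<mu>_def by (simp add: field_simps power2_eq_square)
    moreover have "\<tau>\<^sup>2 * (\<sigma> / s - Lh / s - 2 * (\<tau> - 1) / \<tau> * (\<rho>h / s)) * \<mu>
        = 2 * \<alpha> * (\<tau> * \<sigma> - \<tau> * Lh - 2 * (\<tau> - 1) * \<rho>h)"
      using \<tau> s unfolding \<mu>_def by (simp add: field_simps power2_eq_square)
    ultimately show ?thesis by (simp add: c_def)
  qed
  with neg have "0 < c" by simp
  then have "0 < c / (4 * \<alpha> * \<tau>)" using \<alpha>0 \<tau> by simp
  moreover have "c / (4 * \<alpha> * \<tau>) * (norm (v - x))\<^sup>2 \<le> envelope_decrease \<tau> \<alpha> f h x v" for x v
  proof -
    define d e q where deq: "d = v - x" "e = grad f v - grad f x" "q = grad h v - grad h x"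
    define n where "n = (norm d)\<^sup>2"
    define B where "B = bregman f x v"
    have n0: "0 \<le> n" by (simp add: n_def)
    have B0: "\<sigma> * n \<le> 2 * B"
      using smooth_with_lower[OF f cvx, of v x]
      by (simp add: B_def bregman_def n_def deq norm_minus_commute)
    have i: "(norm (e + (- \<sigma>) *\<^sub>R d))\<^sup>2 \<le> (Lf - \<sigma>) * (2 * B - \<sigma> * n)"
      using smooth_with_interpolation[OF f cvx, where x = x and v = v] \<sigma>L
      by (simp add: B_def bregman_def n_def deq)
    have ex: "(norm (e + (- t) *\<^sub>R d))\<^sup>2 = (norm e)\<^sup>2 - 2 * t * (e \<bullet> d) + t\<^sup>2 * n" for t
      unfolding power2_norm_eq_inner n_def
      by (simp add: inner_diff_left inner_diff_right inner_commute power2_eq_square algebra_simps)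
    \<comment> \<open>The combination \<open>Lf |e - \<sigma> d|^2 - \<sigma> |e - Lf d|^2\<close>
      is free of \<open>e \<bullet> d\<close> and equals the left side of the next
      inequality.\<close>
    have "0 \<le> \<sigma> * (norm (e + (- Lf) *\<^sub>R d))\<^sup>2" using \<sigma> by simp
    then have "(Lf - \<sigma>) * ((norm e)\<^sup>2 - \<sigma> * Lf * n) \<le> Lf * (norm (e + (- \<sigma>) *\<^sub>R d))\<^sup>2"
      unfolding ex by (simp add: algebra_simps power2_eq_square)
    also have "\<dots> \<le> Lf * ((Lf - \<sigma>) * (2 * B - \<sigma> * n))"
      using i nn(1) by (rule mult_left_mono)
    finally have i2: "(Lf - \<sigma>) * ((norm e)\<^sup>2 - \<sigma> * Lf * n) \<le> (Lf - \<sigma>) * (Lf * (2 * B - \<sigma> * n))"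
      by (simp add: mult_ac)
    have i3: "(norm e)\<^sup>2 - \<sigma> * Lf * n \<le> Lf * (2 * B - \<sigma> * n)"
    \<comment> \<open>For \<open>\<sigma> = Lf\<close> the factor \<open>Lf - \<sigma>\<close>
      cannot be cancelled, and the Lipschitz bound steps in.\<close>
    proof (cases "\<sigma> = Lf")
      case True
      have "(norm e)\<^sup>2 \<le> \<sigma> * Lf * n"
        using inner_grad_diff_le(3)[OF f h, of v x] True by (simp add: n_def deq power2_eq_square)
      moreover have "0 \<le> Lf * (2 * B - \<sigma> * n)" using B0 nn by simp
      ultimately show ?thesis by linarith
    next
      case False
      then have "0 < Lf - \<sigma>" using \<sigma>L by simp
      with i2 show ?thesis by (simp only: mult_le_cancel_left_pos)
    qed
    \<comment> \<open>If the left side is positive, \<open>i3\<close> is combined with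
      \<open>2 * \<alpha> * Lf \<le> 2 \<le> \<tau>\<close>.\<close>
    have Bf: "2 * \<alpha> * ((norm e)\<^sup>2 - \<sigma> * Lf * n) \<le> \<tau> * (2 * B - \<sigma> * n)"
    proof (cases "(norm e)\<^sup>2 \<le> \<sigma> * Lf * n")
      case True
      then have "2 * \<alpha> * ((norm e)\<^sup>2 - \<sigma> * Lf * n) \<le> 0" using \<alpha>0 by (simp add: mult_nonneg_nonpos)
      moreover have "0 \<le> \<tau> * (2 * B - \<sigma> * n)" using B0 \<tau> by simp
      ultimately show ?thesis by linarith
    next
      case False
      have "\<alpha> * Lf \<le> 1" using \<alpha>s \<alpha>0 nn by (simp add: s_def distrib_left) (smt (verit) mult_nonneg_nonneg)
      have "2 * \<alpha> * ((norm e)\<^sup>2 - \<sigma> * Lf * n) \<le> 2 * \<alpha> * (Lf * (2 * B - \<sigma> * n))"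
        using i3 \<alpha>0 by (intro mult_left_mono) auto
      also have "\<dots> = (2 * (\<alpha> * Lf)) * (2 * B - \<sigma> * n)" by simp
      also have "\<dots> \<le> \<tau> * (2 * B - \<sigma> * n)"
        using \<open>\<alpha> * Lf \<le> 1\<close> \<tau> B0 by (intro mult_right_mono) auto
      finally show ?thesis .
    qed
    have Bh: "- (\<tau> - 1) * \<rho>h * n - \<tau> * Lh / 2 * n \<le> \<tau> * bregman h x v - q \<bullet> d"
    proof -
      have "(\<tau> - 1) * (- \<rho>h * n) \<le> (\<tau> - 1) * (q \<bullet> d)"
        using weakly_convex_monotone[OF h cvxh, of v x] \<tau>
        by (intro mult_left_mono) (auto simp: n_def deq)
      then show ?thesis
        using mult_left_mono[OF bregman_ge_inner[OF h, of v x], of \<tau>] \<tau>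
        by (simp add: n_def deq algebra_simps)
    qed
    have cross: "q \<bullet> e \<le> Lh * (Lf\<^sup>2 - \<sigma>\<^sup>2) / Lf * n + \<sigma> * Lh * n"
    proof -
      \<comment> \<open>The Cauchy-Schwarz constant \<open>Lf * Lh\<close> is relaxed, by
        \<open>\<sigma> \<le> Lf\<close>, to the expression from which \<open>\<theta>0\<close> is
        built.\<close>
      have "Lf * Lh \<le> Lh * (Lf\<^sup>2 - \<sigma>\<^sup>2) / Lf + \<sigma> * Lh"
      proof -
        have "Lh * \<sigma> * \<sigma> \<le> Lh * \<sigma> * Lf" using \<sigma> \<sigma>L nn by (intro mult_left_mono) auto
        then show ?thesis using Lf by (simp add: field_simps power2_eq_square)
      qed
      from mult_right_mono[OF this n0] inner_grad_diff_le(1)[OF f h, of v x]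
      show ?thesis by (simp add: n_def deq algebra_simps)
    qed
    have "envelope_decrease \<tau> \<alpha> f h x v * (4 * \<alpha> * \<tau>)
        = 2 * \<alpha> * (\<tau> * (2 * B) - 2 * \<alpha> * (norm e)\<^sup>2) + 4 * \<alpha> * (\<tau> * bregman h x v - q \<bullet> d)
          - 4 * \<alpha>\<^sup>2 * (q \<bullet> e) + 2 * (2 - \<tau>) * n"
      using \<tau> \<alpha>0
      by (simp add: envelope_decrease_def Let_def flip: deq n_def B_def)
         (simp add: field_simps power2_eq_square)
    moreover have "2 * \<alpha> * (2 * \<alpha> * ((norm e)\<^sup>2 - \<sigma> * Lf * n)) \<le> 2 * \<alpha> * (\<tau> * (2 * B - \<sigma> * n))"
      "4 * \<alpha> * (- (\<tau> - 1) * \<rho>h * n - \<tau> * Lh / 2 * n) \<le> 4 * \<alpha> * (\<tau> * bregman h x v - q \<bullet> d)"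
      "4 * \<alpha>\<^sup>2 * (q \<bullet> e) \<le> 4 * \<alpha>\<^sup>2 * (Lh * (Lf\<^sup>2 - \<sigma>\<^sup>2) / Lf * n + \<sigma> * Lh * n)"
      using \<alpha>0 by (intro mult_left_mono Bf Bh cross; simp)+
    moreover have "c * n = 2 * \<alpha> * (\<tau> * \<sigma> * n) - 2 * \<alpha> * (2 * \<alpha> * (\<sigma> * Lf * n))
        + 4 * \<alpha> * (- (\<tau> - 1) * \<rho>h * n - \<tau> * Lh / 2 * n)
        - 4 * \<alpha>\<^sup>2 * (Lh * (Lf\<^sup>2 - \<sigma>\<^sup>2) / Lf * n + \<sigma> * Lh * n) + 2 * (2 - \<tau>) * n"
      unfolding c_def s_def by (simp add: algebra_simps power2_eq_square)
    ultimately have "c * n \<le> envelope_decrease \<tau> \<alpha> f h x v * (4 * \<alpha> * \<tau>)"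
      by (simp only: right_diff_distrib)
    then show ?thesis
      using \<tau> \<alpha>0 by (simp add: n_def deq field_simps)
  qed
  ultimately show "\<exists>c>0. \<forall>x v. c * (norm (v - x))\<^sup>2 \<le> envelope_decrease \<tau> \<alpha> f h x v" by blast
qed

section \<open>Proximal steps and the model function\<close>

text \<open>The hypothesis on \<open>w\<close> is the update of \<open>z\<close>, rewritten with \<open>z = x + \<alpha> \<nabla>f x\<close>; it eliminates \<open>w\<close>.\<close>
lemma envelope_decrease_eq:
  fixes f h :: "real^'n \<Rightarrow> real" and x v w :: "real^'n"
  assumes "\<tau> \<noteq> 0" "\<alpha> \<noteq> 0"
    and w: "(v + \<alpha> *\<^sub>R grad f v) - (x + \<alpha> *\<^sub>R grad f x) = \<tau> *\<^sub>R (w - x)"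
  defines "M \<equiv> \<lambda>x. f x + h x + (grad f x + grad h x) \<bullet> (w - x) + (norm (w - x))\<^sup>2 / (2 * \<alpha>)"
  shows "M x - M v = envelope_decrease \<tau> \<alpha> f h x v"
proof -
  define d e q where deq: "d = v - x" "e = grad f v - grad f x" "q = grad h v - grad h x"
  define r where "r = w - x"
  have r: "r = (1 / \<tau>) *\<^sub>R (d + \<alpha> *\<^sub>R e)"
  proof -
    have "d + \<alpha> *\<^sub>R e = \<tau> *\<^sub>R r"
      using w by (simp add: deq r_def algebra_simps)
    then show ?thesis using assms(1) by simp
  qed
  have eq: "w - x = r" "w - v = r - d" "x - v = - d" "grad f v = grad f x + e" "grad h v = grad h x + q"
    by (simp_all add: r_def deq)
  have n: "(norm (r - d))\<^sup>2 = (norm r)\<^sup>2 - 2 * (r \<bullet> d) + (norm d)\<^sup>2"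
    unfolding power2_norm_eq_inner by (simp add: inner_diff_left inner_diff_right inner_commute)
  have "M x - M v = bregman f x v + bregman h x v - (e + q) \<bullet> r + (2 * (r \<bullet> d) - (norm d)\<^sup>2) / (2 * \<alpha>)"
    unfolding M_def bregman_def eq n using assms(2)
    by (simp add: inner_add_left inner_add_right inner_diff_right field_simps)
  also have "(e + q) \<bullet> r = (e \<bullet> d + q \<bullet> d + \<alpha> * (norm e)\<^sup>2 + \<alpha> * (q \<bullet> e)) / \<tau>"
    unfolding r power2_norm_eq_inner
    by (simp add: inner_add_left inner_add_right add_divide_distrib distrib_left)
  also have "r \<bullet> d = ((norm d)\<^sup>2 + \<alpha> * (e \<bullet> d)) / \<tau>"
    unfolding r power2_norm_eq_inner by (simp add: inner_add_left add_divide_distrib)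
  also have "bregman f x v + bregman h x v
      - (e \<bullet> d + q \<bullet> d + \<alpha> * (norm e)\<^sup>2 + \<alpha> * (q \<bullet> e)) / \<tau>
      + (2 * (((norm d)\<^sup>2 + \<alpha> * (e \<bullet> d)) / \<tau>) - (norm d)\<^sup>2) / (2 * \<alpha>)
    = bregman f x v + bregman h x v - \<alpha> / \<tau> * (norm e)\<^sup>2 - q \<bullet> d / \<tau> - \<alpha> / \<tau> * (q \<bullet> e)
      + (2 - \<tau>) / (2 * \<alpha> * \<tau>) * (norm d)\<^sup>2"
    using assms(1,2) by (simp add: field_simps)
  finally show ?thesis
    unfolding envelope_decrease_def Let_def deq[symmetric] .
qed

text \<open>Fermat's rule for the prox objective. It expresses \<open>z\<close> through
  \<open>x\<close>, so that increments of \<open>x\<close> control those of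
  \<open>z\<close>.\<close>

lemma prox_smooth_stationary:
  assumes f: "smooth_with L f" and "0 < \<alpha>" and x: "x \<in> prox \<alpha> (\<lambda>w. ereal (f w)) z"
  shows "z = x + \<alpha> *\<^sub>R grad f x"
proof -
  have min: "f x + 1 / (2 * \<alpha>) * ((x - z) \<bullet> (x - z)) \<le> f w + 1 / (2 * \<alpha>) * ((w - z) \<bullet> (w - z))" for w
    using x by (auto simp: prox_def is_arg_min_def not_less power2_norm_eq_inner)
  define F where "F = (\<lambda>w. f w + 1 / (2 * \<alpha>) * ((w - z) \<bullet> (w - z)))"
  have "(f has_derivative (\<lambda>h. h \<bullet> grad f x)) (at x)"
    using f by (simp add: smooth_with_def gderiv_def)
  then have D: "(F has_derivative
      (\<lambda>h. h \<bullet> grad f x + 1 / (2 * \<alpha>) * ((x - z) \<bullet> h + h \<bullet> (x - z)))) (at x)"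
    using \<open>0 < \<alpha>\<close> unfolding F_def by (auto intro!: derivative_eq_intros simp: field_simps)
  have "(\<lambda>h. h \<bullet> grad f x + 1 / (2 * \<alpha>) * ((x - z) \<bullet> h + h \<bullet> (x - z))) = (\<lambda>h. 0)"
    by (rule has_derivative_local_min[OF D]) (use min in \<open>auto simp: F_def\<close>)
  then have "h \<bullet> grad f x + 1 / (2 * \<alpha>) * ((x - z) \<bullet> h + h \<bullet> (x - z)) = 0" for h
    by meson
  then have "h \<bullet> (x - z) + \<alpha> * (h \<bullet> grad f x) = 0" for h
    using \<open>0 < \<alpha>\<close> by (simp add: inner_commute[of "x - z"] field_simps)
  then have "h \<bullet> ((x - z) + \<alpha> *\<^sub>R grad f x) = 0" for h
    by (simp only: inner_add_right inner_scaleR_right)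
  from this[of "(x - z) + \<alpha> *\<^sub>R grad f x"]
  have "(x - z) + \<alpha> *\<^sub>R grad f x = 0" by (simp only: inner_eq_zero_iff)
  then show ?thesis by (simp add: algebra_simps)
qed

text \<open>Two minimizers are both stationary, hence differ by \<alpha> times a gradient
  difference; for distinct points that is shorter than their distance.\<close>

lemma prox_smooth_unique:
  assumes f: "smooth_with L f" and "0 < \<alpha>" "\<alpha> * L < 1" and x: "x \<in> prox \<alpha> (\<lambda>w. ereal (f w)) z"
  shows "prox \<alpha> (\<lambda>w. ereal (f w)) z = {x}"
proof -
  have "x' = x" if x': "x' \<in> prox \<alpha> (\<lambda>w. ereal (f w)) z" for x'
  proof (rule ccontr)
    assume "x' \<noteq> x"
    have "x' - x = \<alpha> *\<^sub>R (grad f x - grad f x')"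
      using prox_smooth_stationary[OF f assms(2) x] prox_smooth_stationary[OF f assms(2) x']
      by (simp add: algebra_simps)
    then have "norm (x' - x) = \<alpha> * norm (grad f x - grad f x')"
      using \<open>0 < \<alpha>\<close> by simp
    also have "\<dots> \<le> \<alpha> * (L * norm (x - x'))"
      using \<open>0 < \<alpha>\<close> by (intro mult_left_mono smooth_with_lipschitz[OF f]) auto
    also have "\<dots> = (\<alpha> * L) * norm (x' - x)" by (simp add: norm_minus_commute)
    also have "\<dots> < 1 * norm (x' - x)"
      using \<open>x' \<noteq> x\<close> assms(3) by (intro mult_strict_right_mono) auto
    finally show False by simp
  qed
  then show ?thesis using x by blast
qed

lemma prox_real_argmin:
  assumes g: "proper g" and y: "y \<in> prox \<gamma> g v"
  shows "\<bar>g y\<bar> \<noteq> \<infinity>"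
    and "\<bar>g w\<bar> \<noteq> \<infinity> \<Longrightarrow> real_of_ereal (g y) + 1 / (2 * \<gamma>) * (norm (y - v))\<^sup>2
       \<le> real_of_ereal (g w) + 1 / (2 * \<gamma>) * (norm (w - v))\<^sup>2"
proof -
  have min: "g y + ereal (1 / (2 * \<gamma>) * (norm (y - v))\<^sup>2) \<le> g w + ereal (1 / (2 * \<gamma>) * (norm (w - v))\<^sup>2)" for w
    using y by (auto simp: prox_def is_arg_min_def not_less)
  obtain w0 where w0: "g w0 < \<infinity>" using g by (auto simp: proper_def edom_def)
  have ninf: "g u \<noteq> - \<infinity>" for u using g by (simp add: proper_def)
  show fin: "\<bar>g y\<bar> \<noteq> \<infinity>"
    using min[of w0] w0 ninf[of y] by (cases "g y"; cases "g w0") auto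
  show "real_of_ereal (g y) + 1 / (2 * \<gamma>) * (norm (y - v))\<^sup>2
       \<le> real_of_ereal (g w) + 1 / (2 * \<gamma>) * (norm (w - v))\<^sup>2" if "\<bar>g w\<bar> \<noteq> \<infinity>"
    using min[of w] fin that by (cases "g y"; cases "g w") auto
qed

text \<open>Completing the square: the quadratic of the prox step and the model differ by a constant
  in \<open>w\<close>, so they have the same minimizers after \<open>g\<close> is added. The real
  number \<open>b\<close> stands for \<open>1 / \<beta>\<close>.\<close>

lemma forward_point_model:
  fixes w x y z \<xi> :: "real^'n"
  assumes "0 < \<gamma>" "0 < \<alpha>" "1 / \<gamma> = 1 / \<alpha> + b" "real_of_ereal (ereal \<gamma> / \<beta>) = \<gamma> * b"
    and "z = x + \<alpha> *\<^sub>R a"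
  shows "\<exists>C. \<forall>w. 1 / (2 * \<gamma>) * (norm (w - forward_point \<alpha> \<beta> \<gamma> h x y z \<xi>))\<^sup>2
    = (a + grad h x) \<bullet> (w - x) + (norm (w - x))\<^sup>2 / (2 * \<alpha>) + \<xi> \<bullet> (w - y) + b / 2 * (norm (w - y))\<^sup>2 + C"
proof -
  define s where "s = (1 / \<alpha>) *\<^sub>R x - a - grad h x + b *\<^sub>R y - \<xi>"
  have fp: "forward_point \<alpha> \<beta> \<gamma> h x y z \<xi> = \<gamma> *\<^sub>R s"
  proof -
    have "2 *\<^sub>R x - z - \<alpha> *\<^sub>R grad h x = \<alpha> *\<^sub>R ((1 / \<alpha>) *\<^sub>R x - a - grad h x)"
      using assms(2) by (simp add: assms(5) scaleR_diff_right) (simp add: algebra_simps scaleR_2)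
    then show ?thesis
      using assms(2) by (simp add: forward_point_def assms(4) s_def scaleR_add_right scaleR_diff_right)
  qed
  define Q where "Q = (\<lambda>w. (a + grad h x) \<bullet> (w - x) + (norm (w - x))\<^sup>2 / (2 * \<alpha>)
      + \<xi> \<bullet> (w - y) + b / 2 * (norm (w - y))\<^sup>2)"
  have "1 / (2 * \<gamma>) * (norm (w - \<gamma> *\<^sub>R s))\<^sup>2 = Q w + (\<gamma> / 2 * (s \<bullet> s) - Q 0)" for w
  proof -
    have "1 / (2 * \<gamma>) * (norm (w - \<gamma> *\<^sub>R s))\<^sup>2 = (1 / \<gamma>) / 2 * (w \<bullet> w) - w \<bullet> s + \<gamma> / 2 * (s \<bullet> s)"
      using assms(1) unfolding power2_norm_eq_inner
      by (simp add: inner_diff_left inner_diff_right inner_commute field_simps)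
    also have "(1 / \<gamma>) / 2 * (w \<bullet> w) - w \<bullet> s = Q w - Q 0"
      unfolding assms(3) Q_def s_def power2_norm_eq_inner
      by (simp add: inner_diff_left inner_diff_right inner_add_left inner_add_right
          inner_commute add_divide_distrib diff_divide_distrib algebra_simps)
    finally show ?thesis by simp
  qed
  then show ?thesis unfolding fp Q_def by blast
qed

section \<open>Boundedness of the objective from below\<close>

lemma lower_semicont_bounded_below:
  fixes g :: "real^'n \<Rightarrow> ereal"
  assumes lsc: "lower_semicont g" and ninf: "\<And>x. g x \<noteq> - \<infinity>" and "compact K"
  shows "\<exists>m::real. \<forall>w\<in>K. ereal m \<le> g w"
proof (rule ccontr)
  assume "\<not> ?thesis"
  then have *: "\<not> (\<forall>w\<in>K. ereal m \<le> g w)" for m by blast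
  have "\<forall>n::nat. \<exists>w. w \<in> K \<and> g w < ereal (- real n)"
    using *[of "- real n" for n] by (auto simp: not_le)
  then obtain u where u: "\<And>n. u n \<in> K" "\<And>n. g (u n) < ereal (- real n)"
    using choice[of "\<lambda>n w. w \<in> K \<and> g w < ereal (- real n)"] by blast
  obtain l r where l: "l \<in> K" "strict_mono r" "(u \<circ> r) \<longlonglongrightarrow> l"
    using \<open>compact K\<close> u(1) unfolding compact_def by blast
  obtain t :: real where t: "ereal t < g l"
  proof (cases "g l")
    case (real a)
    then show ?thesis using that[of "a - 1"] by simp
  next
    case PInf
    then show ?thesis using that[of 0] by simp
  qed (use ninf in simp)
  have "ereal t < Liminf (at l) g"
    using t lsc by (auto simp: lower_semicont_def intro: less_le_trans)
  then have "\<forall>\<^sub>F w in at l. ereal t < g w" by (rule less_LiminfD)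
  \<comment> \<open>The lower limit ignores \<open>l\<close> itself; \<open>t < g l\<close> covers
    that point, since the subsequence may take the value \<open>l\<close>.\<close>
  then have "\<forall>\<^sub>F w in nhds l. ereal t < g w"
    using t by (auto simp: eventually_at_filter elim: eventually_mono)
  from eventually_compose_filterlim[OF this l(3)]
  have ev: "\<forall>\<^sub>F n in sequentially. ereal t < g (u (r n))" by simp
  obtain N :: nat where N: "- t \<le> real N" using real_arch_simple by blast
  have "\<forall>\<^sub>F n in sequentially. False"
    using ev eventually_ge_at_top[of N]
  proof eventually_elim
    case (elim n)
    have "n \<le> r n" using l(2) by (rule seq_suble)
    then have "- real (r n) \<le> t" using N elim(2) by simp
    then have "g (u (r n)) < ereal t" using u(2)[of "r n"] by (meson ereal_less_eq(3) less_le_trans)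
    with elim(1) show False by simp
  qed
  then show False by simp
qed

text \<open>The level set at 0 lies in a ball, on which \<open>g\<close> is bounded below by
  semicontinuity and the rest by continuity; off the ball the sum is positive.\<close>

lemma objective_bounded_below:
  fixes f h p :: "real^'n \<Rightarrow> real" and g :: "real^'n \<Rightarrow> ereal"
  assumes "continuous_on UNIV f" "continuous_on UNIV h" "continuous_on UNIV p"
    and g: "proper g" "lower_semicont g"
    and bdd: "bounded {w. ereal (f w) + g w + ereal (h w) + ereal (p w) \<le> ereal 0}"
  shows "\<exists>m::real. \<forall>w. \<bar>g w\<bar> \<noteq> \<infinity> \<longrightarrow> m \<le> f w + real_of_ereal (g w) + h w + p w"
proof -
  let ?S = "{w. ereal (f w) + g w + ereal (h w) + ereal (p w) \<le> ereal 0}"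
  from bdd obtain R where R: "\<And>w. w \<in> ?S \<Longrightarrow> norm w \<le> R"
    unfolding bounded_iff by meson
  define K where "K = cball (0 :: real^'n) R"
  have K: "compact K" by (simp add: K_def)
  obtain m1 where m1: "\<forall>w\<in>K. ereal m1 \<le> g w"
    using lower_semicont_bounded_below[OF g(2) _ K] g(1) by (auto simp: proper_def)
  have "continuous_on K (\<lambda>w. f w + h w + p w)"
    by (intro continuous_on_add) (rule continuous_on_subset[OF assms(1)] continuous_on_subset[OF assms(2)]
        continuous_on_subset[OF assms(3)], simp)+
  then have "compact ((\<lambda>w. f w + h w + p w) ` K)"
    using K by (rule compact_continuous_image)
  from bounded_imp_bdd_below[OF compact_imp_bounded[OF this]]
  obtain m2 where m2: "\<And>w. w \<in> K \<Longrightarrow> m2 \<le> f w + h w + p w"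
    by (auto simp: bdd_below_def)
  have "min 0 (m1 + m2) \<le> f w + real_of_ereal (g w) + h w + p w" if "\<bar>g w\<bar> \<noteq> \<infinity>" for w
  proof (cases "w \<in> K")
    case True
    then have "m1 \<le> real_of_ereal (g w)" using m1 that by (cases "g w") auto
    with m2[OF True] show ?thesis by simp
  next
    case False
    then have "w \<notin> ?S" using R[of w] unfolding K_def mem_cball_0 by meson
    then show ?thesis using that by (cases "g w") auto
  qed
  then show ?thesis by blast
qed

text \<open>Treats finite and infinite \<beta> at once through a real \<open>b\<close>, namely
  \<open>1 / r\<close> or 0. In the infinite case the bound on \<beta> forces
  \<open>\<rho> = 0\<close>, because \<open>1 / \<rho>\<close> would otherwise be finite.\<close>

lemma reciprocal_beta:
  fixes \<beta> :: ereal
  assumes "0 < \<beta>" "\<beta> \<le> 1 / ereal \<rho>" "0 \<le> \<rho>" "0 < \<gamma>" "0 < \<alpha>"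
    and "1 / ereal \<gamma> = 1 / ereal \<alpha> + 1 / \<beta>"
  obtains b where "\<rho> \<le> b" "1 / \<gamma> = 1 / \<alpha> + b" "real_of_ereal (ereal \<gamma> / \<beta>) = \<gamma> * b"
proof (cases \<beta>)
  case (real r)
  with assms have r: "0 < r" by simp
  have "\<rho> \<le> 1 / r"
  proof (cases "\<rho> = 0")
    case False
    then have "0 < \<rho>" using assms by simp
    then have "r \<le> 1 / \<rho>" using assms(2) real by (simp add: one_ereal_def)
    then show ?thesis using r \<open>0 < \<rho>\<close> by (simp add: field_simps)
  qed (use r in simp)
  moreover have "1 / \<gamma> = 1 / \<alpha> + 1 / r"
    using assms real r by (simp add: one_ereal_def)
  ultimately show ?thesis
    using that[of "1 / r"] real r by simp
next
  case PInf
  have "\<rho> \<le> 0"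
  proof (rule ccontr)
    assume "\<not> \<rho> \<le> 0"
    then show False using assms(2) PInf by (simp add: one_ereal_def)
  qed
  moreover have "1 / \<gamma> = 1 / \<alpha> + 0" using assms PInf by (simp add: one_ereal_def)
  ultimately show ?thesis using that[of 0] PInf by simp
qed (use assms in simp)

section \<open>Residual estimate and convergence rate\<close>

lemma admissible_decrease:
  assumes "smooth_with Lf f" "smooth_with Lh h" "Lf + Lh > 0" "weakly_convex \<rho> f" "\<rho> \<le> Lf"
    and "admissible Lf Lh \<rho> f h \<tau> \<alpha>"
  shows "\<exists>c>0. \<forall>x v. c * (norm (v - x))\<^sup>2 \<le> envelope_decrease \<tau> \<alpha> f h x v"
    and "\<alpha> * (Lf + Lh) < 1" and "0 < \<tau>" and "0 < \<alpha>"
proof -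
  note ad = assms(6)[unfolded admissible_def]
  show "\<exists>c>0. \<forall>x v. c * (norm (v - x))\<^sup>2 \<le> envelope_decrease \<tau> \<alpha> f h x v"
    using ad admissible_A_decrease(1)[OF assms(1-5)] admissible_B_decrease(1)[OF assms(1,2,4,5)]
      admissible_C_decrease(1)[OF assms(1,2)] by blast
  show "\<alpha> * (Lf + Lh) < 1"
    using ad admissible_A_decrease(2)[OF assms(1-5)] admissible_B_decrease(2)[OF assms(1,2,4,5)]
      admissible_C_decrease(2)[OF assms(1,2)] by blast
  show "0 < \<tau>" "0 < \<alpha>"
    using ad by (auto simp: admissible_A_def admissible_B_def admissible_C_def Let_def)
qed

text \<open>The distance to the set is at most the distance to the element chosen by the algorithm,
  and the product norm splits into its two components.\<close>

lemma residual_le: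
  assumes "prox \<alpha> (\<lambda>w. ereal (f w)) z = {x}" "\<xi> \<in> limiting_subdiff p y"
    and "y' \<in> prox \<gamma> g (forward_point \<alpha> \<beta> \<gamma> h x y z \<xi>)"
  shows "(residual \<tau> \<alpha> \<beta> \<gamma> f g h p y z)\<^sup>2 \<le> (norm (y' - y))\<^sup>2 + (norm (\<tau> *\<^sub>R (y' - x)))\<^sup>2"
proof -
  have "y' \<in> P_op \<alpha> \<beta> \<gamma> f g h p y z"
    using assms by (auto simp: P_op_def)
  then have "(y', z + \<tau> *\<^sub>R (y' - x)) \<in> T_op \<tau> \<alpha> \<beta> \<gamma> f g h p y z"
    unfolding T_op_def assms(1) the_elem_eq by (rule image_eqI[rotated]) simp
  then have "residual \<tau> \<alpha> \<beta> \<gamma> f g h p y z \<le> dist 0 ((y, z) - (y', z + \<tau> *\<^sub>R (y' - x)))"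
    unfolding residual_def by (intro infdist_le imageI)
  also have "\<dots> = norm (y - y', - (\<tau> *\<^sub>R (y' - x)))"
    by (simp add: dist_norm norm_Pair norm_minus_commute)
  finally have "residual \<tau> \<alpha> \<beta> \<gamma> f g h p y z \<le> norm (y - y', - (\<tau> *\<^sub>R (y' - x)))" .
  moreover have "0 \<le> residual \<tau> \<alpha> \<beta> \<gamma> f g h p y z"
    by (simp add: residual_def infdist_nonneg)
  ultimately have "(residual \<tau> \<alpha> \<beta> \<gamma> f g h p y z)\<^sup>2 \<le> (norm (y - y', - (\<tau> *\<^sub>R (y' - x))))\<^sup>2"
    by (rule power_mono)
  also have "\<dots> = (norm (y' - y))\<^sup>2 + (norm (\<tau> *\<^sub>R (y' - x)))\<^sup>2"
    unfolding norm_Pair norm_minus_cancel by (simp add: norm_minus_commute)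
  finally show ?thesis .
qed

lemma Min_le_average:
  fixes r :: "nat \<Rightarrow> real"
  assumes "0 < T" "(\<Sum>k=1..T. r k) \<le> \<omega>"
  shows "Min (r ` {1..T}) \<le> \<omega> / real T"
proof -
  have "real (card {1..T}) * Min (r ` {1..T}) \<le> (\<Sum>k=1..T. r k)"
    by (rule sum_bounded_below) simp
  with assms show ?thesis by (simp add: field_simps)
qed

theorem theorem3p20:
  fixes f h p :: "real^'n \<Rightarrow> real" and g :: "real^'n \<Rightarrow> ereal"
    and x y z :: "nat \<Rightarrow> real^'n"
    and Lf Lh \<rho>f \<rho>p \<tau> \<alpha> \<gamma> :: real and \<beta> :: ereal
  assumes "standing_assumption Lf Lh \<rho>p f g h p"
    and "\<forall>c::real. bounded {w. ereal (f w) + g w + ereal (h w) + ereal (p w) \<le> ereal c}"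
    and "Lf + Lh > 0"
    and "0 < \<beta>" and "\<beta> \<le> 1 / ereal \<rho>p"
    and "\<gamma> > 0" and "1 / ereal \<gamma> = 1 / ereal \<alpha> + 1 / \<beta>"
    and "\<rho>f \<le> Lf" and "weakly_convex \<rho>f f"
    and "admissible Lf Lh \<rho>f f h \<tau> \<alpha>"
    and "generated \<tau> \<alpha> \<beta> \<gamma> f g h p x y z"
  shows "\<exists>\<omega>>0. \<forall>T>1.
           Min ((\<lambda>k. (residual \<tau> \<alpha> \<beta> \<gamma> f g h p (y k) (z k))\<^sup>2) ` {1..T}) \<le> \<omega> / real T"
proof -
  have f: "smooth_with Lf f" and h: "smooth_with Lh h" and g: "proper g" "lower_semicont g"
    and wp: "weakly_convex \<rho>p (\<lambda>x. - p x)"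
    using assms(1) by (auto simp: standing_assumption_def)
  note adm = admissible_decrease[OF f h assms(3,9,8,10)]
  have \<tau>: "0 < \<tau>" and \<alpha>: "0 < \<alpha>" and \<alpha>L: "\<alpha> * (Lf + Lh) < 1" using adm by auto
  obtain c where c: "0 < c"
    and decr: "\<And>u v. c * (norm (v - u))\<^sup>2 \<le> envelope_decrease \<tau> \<alpha> f h u v"
    using adm(1) by blast
  have "0 \<le> \<rho>p" using wp by (simp add: weakly_convex_def)
  then obtain b where b: "\<rho>p \<le> b" "1 / \<gamma> = 1 / \<alpha> + b" "real_of_ereal (ereal \<gamma> / \<beta>) = \<gamma> * b"
    using reciprocal_beta[OF assms(4,5) _ assms(6) \<alpha> assms(7)] by blast
  have xprox: "x k \<in> prox \<alpha> (\<lambda>w. ereal (f w)) (z k)"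
    and zS: "z (Suc k) = z k + \<tau> *\<^sub>R (y (Suc k) - x k)" for k
    using assms(11) by (auto simp: generated_def)
  have "\<forall>k. \<exists>\<xi>. \<xi> \<in> limiting_subdiff p (y k) \<and>
      y (Suc k) \<in> prox \<gamma> g (forward_point \<alpha> \<beta> \<gamma> h (x k) (y k) (z k) \<xi>)"
    using assms(11) unfolding generated_def by blast
  from choice[OF this] obtain \<xi> where \<xi>: "\<And>k. \<xi> k \<in> limiting_subdiff p (y k)"
    and yprox: "\<And>k. y (Suc k) \<in> prox \<gamma> g (forward_point \<alpha> \<beta> \<gamma> h (x k) (y k) (z k) (\<xi> k))"
    by blast
  have zx: "z k = x k + \<alpha> *\<^sub>R grad f (x k)" for k
    by (rule prox_smooth_stationary[OF f \<alpha> xprox])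
  have "\<alpha> * Lf \<le> \<alpha> * (Lf + Lh)"
    using \<alpha> smooth_with_nonneg[OF h] by (intro mult_left_mono) auto
  then have "\<alpha> * Lf < 1" using \<alpha>L by linarith
  then have single: "prox \<alpha> (\<lambda>w. ereal (f w)) (z k) = {x k}" for k
    by (rule prox_smooth_unique[OF f \<alpha> _ xprox])

  have contf: "continuous_on UNIV f" and conth: "continuous_on UNIV h"
    using smooth_with_continuous[OF f] smooth_with_continuous[OF h] .
  \<comment> \<open>\<open>p\<close> is a quadratic minus a finite convex function, hence continuous
    on the whole space.\<close>
  have "continuous_on UNIV (\<lambda>w. \<rho>p / 2 * (norm w)\<^sup>2 - (- p w + \<rho>p / 2 * (norm w)\<^sup>2))"
    using wp by (intro continuous_on_diff convex_on_continuous continuous_intros) (auto simp: weakly_convex_def)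
  then have contp: "continuous_on UNIV p" by simp
  obtain m where m: "\<And>w. \<bar>g w\<bar> \<noteq> \<infinity> \<Longrightarrow> m \<le> f w + real_of_ereal (g w) + h w + p w"
    using objective_bounded_below[OF contf conth contp g] assms(2) by blast

  define G where "G = (\<lambda>w. real_of_ereal (g w))"
  define M where "M = (\<lambda>u w. f u + h u + (grad f u + grad h u) \<bullet> (w - u) + (norm (w - u))\<^sup>2 / (2 * \<alpha>))"
  define N where "N = (\<lambda>k w. p (y k) + \<xi> k \<bullet> (w - y k) + b / 2 * (norm (w - y k))\<^sup>2)"
  \<comment> \<open>All values are taken at \<open>y (Suc k)\<close>, where the prox step makes
    \<open>g\<close> finite; \<open>y 0\<close> is arbitrary and may lie outside the domain of
    \<open>g\<close>.\<close>
  define E where "E = (\<lambda>k. M (x k) (y (Suc k)) + G (y (Suc k)) + N k (y (Suc k)))"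
  define a where "a = (\<lambda>k. norm (x (Suc k) - x k))"
  have fin: "\<bar>g (y (Suc k))\<bar> \<noteq> \<infinity>" for k
    by (rule prox_real_argmin(1)[OF g(1) yprox])
  have pN: "p w \<le> N k w" for k w
  proof -
    have "\<rho>p / 2 * (norm (w - y k))\<^sup>2 \<le> b / 2 * (norm (w - y k))\<^sup>2"
      using b(1) by (intro mult_right_mono) auto
    with limiting_subdiff_upper[OF wp \<xi>, of w k] show ?thesis unfolding N_def by linarith
  qed
  have fhM: "f w + h w \<le> M u w" for u w
  proof -
    have "(Lf + Lh) / 2 \<le> 1 / (2 * \<alpha>)" using \<alpha>L \<alpha> by (simp add: field_simps)
    then have "(Lf + Lh) / 2 * (norm (w - u))\<^sup>2 \<le> 1 / (2 * \<alpha>) * (norm (w - u))\<^sup>2"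
      by (rule mult_right_mono) simp
    moreover have "(Lf + Lh) / 2 * (norm (w - u))\<^sup>2
        = Lf / 2 * (norm (w - u))\<^sup>2 + Lh / 2 * (norm (w - u))\<^sup>2"
      by (simp add: field_simps)
    ultimately show ?thesis
      using smooth_with_upper[OF f, of w u] smooth_with_upper[OF h, of w u]
      unfolding M_def inner_add_left by simp
  qed
  have lower: "m \<le> E k" for k
    using m[OF fin, of k] fhM[of "y (Suc k)" "x k"] pN[of "y (Suc k)" k]
    unfolding E_def G_def by linarith
  have step: "E (Suc k) + c * (a k)\<^sup>2 \<le> E k" for k
  proof -
    \<comment> \<open>A competitor in the prox step that produces the next \<open>y\<close>. The new
      model of \<open>p\<close> is exact at \<open>w\<close>, and the old one lies above
      \<open>p\<close> there.\<close>
    define w where "w = y (Suc k)"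
    obtain C where C: "\<And>u. 1 / (2 * \<gamma>) * (norm (u - forward_point \<alpha> \<beta> \<gamma> h (x (Suc k)) (y (Suc k)) (z (Suc k)) (\<xi> (Suc k))))\<^sup>2
        = (grad f (x (Suc k)) + grad h (x (Suc k))) \<bullet> (u - x (Suc k)) + (norm (u - x (Suc k)))\<^sup>2 / (2 * \<alpha>)
          + \<xi> (Suc k) \<bullet> (u - y (Suc k)) + b / 2 * (norm (u - y (Suc k)))\<^sup>2 + C"
      using forward_point_model[OF assms(6) \<alpha> b(2,3) zx] by blast
    from prox_real_argmin(2)[OF g(1) yprox[of "Suc k"] fin[of k], unfolded C]
    have "E (Suc k) \<le> M (x (Suc k)) w + G w + N (Suc k) w"
      unfolding E_def M_def N_def G_def w_def by linarith
    moreover have "N (Suc k) w = p w" by (simp add: N_def w_def)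
    moreover have "M (x k) w - M (x (Suc k)) w = envelope_decrease \<tau> \<alpha> f h (x k) (x (Suc k))"
      unfolding M_def
      by (rule envelope_decrease_eq) (use \<tau> \<alpha> zS[of k] zx in \<open>auto simp: w_def\<close>)
    moreover have "c * (a k)\<^sup>2 \<le> envelope_decrease \<tau> \<alpha> f h (x k) (x (Suc k))"
      unfolding a_def by (rule decr)
    moreover have "E k \<ge> M (x k) w + G w + p w"
      using pN[of w k] by (simp add: E_def w_def)
    ultimately show ?thesis by linarith
  qed
  have telescope: "E T + c * (\<Sum>k<T. (a k)\<^sup>2) \<le> E 0" for T
  proof (induction T)
    case (Suc T)
    then show ?case using step[of T] by (simp add: distrib_left)
  qed simp
  have summed: "(\<Sum>k<T. (a k)\<^sup>2) \<le> (E 0 - m) / c" for T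
    using telescope[of T] lower[of T] c by (simp add: field_simps)

  \<comment> \<open>\<open>K\<close> is a Lipschitz constant of
    \<open>x + \<alpha> grad f x\<close>; \<open>H\<close> is a crude common bound for the
    coefficients below.\<close>
  define K where "K = 1 + \<alpha> * Lf"
  define H where "H = 1 + K / \<tau> + K"
  have K: "0 < K" using \<alpha> smooth_with_nonneg[OF f] by (simp add: K_def add_pos_nonneg)
  have H: "1 + K / \<tau> \<le> H" "K \<le> H" "K / \<tau> \<le> H" "0 < H"
    using K \<tau> by (auto simp: H_def add_pos_nonneg add_nonneg_pos)
  have a0: "0 \<le> a k" for k by (simp add: a_def)
  have dz: "norm (z (Suc k) - z k) \<le> K * a k" for k
  proof -
    have "z (Suc k) - z k = (x (Suc k) - x k) + \<alpha> *\<^sub>R (grad f (x (Suc k)) - grad f (x k))"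
      by (simp add: zx algebra_simps)
    then have "norm (z (Suc k) - z k) \<le> a k + \<alpha> * norm (grad f (x (Suc k)) - grad f (x k))"
      using \<alpha> norm_triangle_ineq[of "x (Suc k) - x k" "\<alpha> *\<^sub>R (grad f (x (Suc k)) - grad f (x k))"]
      by (simp add: a_def)
    also have "\<alpha> * norm (grad f (x (Suc k)) - grad f (x k)) \<le> \<alpha> * (Lf * a k)"
      using \<alpha> smooth_with_lipschitz[OF f] by (simp add: a_def)
    finally show ?thesis by (simp add: K_def algebra_simps)
  qed
  have res: "(residual \<tau> \<alpha> \<beta> \<gamma> f g h p (y (Suc j)) (z (Suc j)))\<^sup>2
      \<le> 4 * H\<^sup>2 * ((a j)\<^sup>2 + (a (Suc j))\<^sup>2)" for j
  proof -
    \<comment> \<open>The increment of \<open>y\<close> also involves the previous update of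
      \<open>z\<close>, so the estimate starts at index 1.\<close>
    define k where "k = Suc j"
    have yx: "y (Suc i) = x i + (1 / \<tau>) *\<^sub>R (z (Suc i) - z i)" for i
      using zS[of i] \<tau> by simp
    have "y (Suc k) - y k = (x k - x j) + (1 / \<tau>) *\<^sub>R ((z (Suc k) - z k) - (z k - z j))"
      unfolding k_def yx scaleR_diff_right by simp
    then have "norm (y (Suc k) - y k)
        \<le> norm (x k - x j) + norm ((1 / \<tau>) *\<^sub>R ((z (Suc k) - z k) - (z k - z j)))"
      by (simp only: norm_triangle_ineq)
    also have "\<dots> \<le> a j + (1 / \<tau>) * (K * a k + K * a j)"
    proof -
      have "norm ((z (Suc k) - z k) - (z k - z j)) \<le> K * a k + K * a j"
        using norm_triangle_ineq4[of "z (Suc k) - z k" "z k - z j"] dz[of k] dz[of j]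
        by (simp add: k_def)
      then have "(1 / \<tau>) * norm ((z (Suc k) - z k) - (z k - z j)) \<le> (1 / \<tau>) * (K * a k + K * a j)"
        using \<tau> by (intro mult_left_mono) auto
      then show ?thesis using \<tau> by (simp add: a_def k_def)
    qed
    also have "\<dots> = (1 + K / \<tau>) * a j + K / \<tau> * a k"
      by (simp add: algebra_simps add_divide_distrib)
    also have "\<dots> \<le> H * a j + H * a k"
      using H a0 by (intro add_mono mult_right_mono) auto
    finally have 1: "norm (y (Suc k) - y k) \<le> H * (a j + a k)" by (simp add: algebra_simps)
    have "norm (\<tau> *\<^sub>R (y (Suc k) - x k)) = norm (z (Suc k) - z k)" using zS[of k] by simp
    also have "\<dots> \<le> K * a k" by (rule dz)
    also have "\<dots> \<le> H * (a j + a k)" using H K a0[of j] a0[of k] by (intro mult_mono) auto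
    finally have 2: "norm (\<tau> *\<^sub>R (y (Suc k) - x k)) \<le> H * (a j + a k)" .
    have "(residual \<tau> \<alpha> \<beta> \<gamma> f g h p (y k) (z k))\<^sup>2
        \<le> (norm (y (Suc k) - y k))\<^sup>2 + (norm (\<tau> *\<^sub>R (y (Suc k) - x k)))\<^sup>2"
      by (rule residual_le[OF single \<xi> yprox])
    also have "\<dots> \<le> (H * (a j + a k))\<^sup>2 + (H * (a j + a k))\<^sup>2"
      by (intro add_mono power_mono 1 2) auto
    also have "\<dots> = 2 * H\<^sup>2 * (a j + a k)\<^sup>2" by (simp add: power_mult_distrib)
    also have "\<dots> \<le> 2 * H\<^sup>2 * (2 * ((a j)\<^sup>2 + (a k)\<^sup>2))"
      using sum_squares_bound[of "a j" "a k"] by (intro mult_left_mono) (auto simp: power2_sum)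
    also have "\<dots> = 4 * H\<^sup>2 * ((a j)\<^sup>2 + (a k)\<^sup>2)" by (simp add: algebra_simps)
    finally show ?thesis by (simp add: k_def)
  qed
  \<comment> \<open>Each increment is counted at most twice, with factor
    \<open>4 * H\<^sup>2\<close>; the 1 keeps \<omega> positive even when
    \<open>E 0 = m\<close>.\<close>
  define \<omega> where "\<omega> = 8 * H\<^sup>2 * ((E 0 - m) / c) + 1"
  have "0 \<le> (E 0 - m) / c" using lower[of 0] c by simp
  then have "0 < \<omega>" unfolding \<omega>_def by (intro add_nonneg_pos mult_nonneg_nonneg) auto
  moreover have "Min ((\<lambda>k. (residual \<tau> \<alpha> \<beta> \<gamma> f g h p (y k) (z k))\<^sup>2) ` {1..T}) \<le> \<omega> / real T"
    if "1 < T" for T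
  proof (rule Min_le_average)
    have "(\<Sum>k=1..T. (residual \<tau> \<alpha> \<beta> \<gamma> f g h p (y k) (z k))\<^sup>2)
        = (\<Sum>j<T. (residual \<tau> \<alpha> \<beta> \<gamma> f g h p (y (Suc j)) (z (Suc j)))\<^sup>2)"
      by (rule sum.reindex_bij_witness[of _ Suc "\<lambda>k. k - 1"]) auto
    also have "\<dots> \<le> (\<Sum>j<T. 4 * H\<^sup>2 * ((a j)\<^sup>2 + (a (Suc j))\<^sup>2))"
      by (intro sum_mono res)
    also have "\<dots> = 4 * H\<^sup>2 * ((\<Sum>j<T. (a j)\<^sup>2) + (\<Sum>j<T. (a (Suc j))\<^sup>2))"
      by (simp add: sum_distrib_left[symmetric] sum.distrib)
    also have "\<dots> \<le> 4 * H\<^sup>2 * ((E 0 - m) / c + (E 0 - m) / c)"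
    proof (intro mult_left_mono add_mono summed)
      \<comment> \<open>The shifted sum reaches index \<open>T\<close>, so the bound for
        \<open>Suc T\<close> terms is used.\<close>
      have "(\<Sum>j<T. (a (Suc j))\<^sup>2) \<le> (\<Sum>j<Suc T. (a j)\<^sup>2)"
        by (subst sum.lessThan_Suc_shift) simp
      with summed[of "Suc T"] show "(\<Sum>j<T. (a (Suc j))\<^sup>2) \<le> (E 0 - m) / c" by linarith
    qed simp
    also have "4 * H\<^sup>2 * (q + q) = 8 * H\<^sup>2 * q" for q :: real by simp
    also have "8 * H\<^sup>2 * ((E 0 - m) / c) \<le> \<omega>" by (simp only: \<omega>_def)
    finally show "(\<Sum>k=1..T. (residual \<tau> \<alpha> \<beta> \<gamma> f g h p (y k) (z k))\<^sup>2) \<le> \<omega>" .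
  qed (use that in simp)
  ultimately show ?thesis by blast
qed

end
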